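(* Let $K:(0,\infty)\to\mathbb{R}$ be $C^1$ and strictly decreasing with $\int_0^1 K(r)\,r\,dr<\infty$, and let $D(\Omega)=\int_\Omega\int_\Omega K(|x-y|)\,dx\,dy$. Fix an area $m>0$. For $\alpha\in(0,\pi)$ and $q\ge1$ let $\Omega_{\alpha,q}\subset\mathbb{R}^2$ denote the triangle (unique up to congruence) of area $m$ with one angle equal to $\alpha$ and such that $q$ is the ratio of the lengths (longer to shorter) of the two sides adjacent to that angle. Then, for any fixed $\alpha\in(0,\pi)$, $q\mapsto D(\Omega_{\alpha,q})$ is a strictly decreasing function on $[1,\infty)$.
   Context: $D$ is invariant under rigid motions, so $D(\Omega_{\alpha,q})$ is well defined; the condition $\int_0^1K(r)r\,dr<\infty$ guarantees that $D$ is finite on bounded planar domains. *)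

theory Defs
  imports "HOL-Analysis.Analysis"
begin

text \<open>
  The diagonal \<open>x = y\<close> is a null set, so the value of \<open>K\<close> at \<open>0\<close> is irrelevant.
\<close>

definition interaction_energy :: "(real \<Rightarrow> real) \<Rightarrow> (real ^ 2) set \<Rightarrow> real" where
  "interaction_energy K \<Omega> =
     (LINT x:\<Omega>|lborel. (LINT y:\<Omega>|lborel. K (norm (x - y))))"

text \<open>
  The angle at the vertex \<open>A\<close> between the segments \<open>AB\<close> and \<open>AC\<close>; meaningful only for
  \<open>B \<noteq> A\<close> and \<open>C \<noteq> A\<close>.
\<close>

definition vertex_angle :: "real ^ 2 \<Rightarrow> real ^ 2 \<Rightarrow> real ^ 2 \<Rightarrow> real" where
  "vertex_angle A B C = arccos (((B - A) \<bullet> (C - A)) / (dist A B * dist A C))"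

text \<open>
  Without loss of generality, \<open>AB\<close> is the longer of the two sides adjacent to the
  distinguished angle. The data \<open>m\<close>, \<open>\<alpha>\<close>, \<open>q\<close> determine a triangle only up to congruence, hence
  a predicate rather than a function.
\<close>

definition triangle_angle_ratio :: "real \<Rightarrow> real \<Rightarrow> real \<Rightarrow> (real ^ 2) set \<Rightarrow> bool" where
  "triangle_angle_ratio m \<alpha> q \<Omega> \<longleftrightarrow>
     (\<exists>A B C. \<not> collinear {A, B, C} \<and> \<Omega> = convex hull {A, B, C} \<and>
        measure lborel \<Omega> = m \<and> vertex_angle A B C = \<alpha> \<and>
        dist A C \<le> dist A B \<and> q = dist A B / dist A C)"

lemma triangle_angle_ratio_exists:
  fixes m \<alpha> q :: real
  assumes "m > 0" "0 < \<alpha>" "\<alpha> < pi" "q \<ge> 1"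
  shows "\<exists>\<Omega>. triangle_angle_ratio m \<alpha> q \<Omega>"
proof -
  have sa: "sin \<alpha> > 0"
    using assms by (simp add: sin_gt_zero)
  define s where "s = sqrt (2 * m / (q * sin \<alpha>))"
  have s: "s > 0" "s * s = 2 * m / (q * sin \<alpha>)"
    using assms sa by (auto simp: s_def)
  define A B C :: "real ^ 2"
    where "A = 0" and "B = vector [q * s, 0]" and "C = vector [s * cos \<alpha>, s * sin \<alpha>]"
  have [simp]: "A $ 1 = 0" "A $ 2 = 0" "B $ 1 = q * s" "B $ 2 = 0"
      "C $ 1 = s * cos \<alpha>" "C $ 2 = s * sin \<alpha>"
    by (simp_all add: A_def B_def C_def)
  have dB: "dist A B = q * s"
    using assms s by (simp add: dist_vec_def L2_set_def UNIV_2 dist_real_def)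
  have "(s * cos \<alpha>)\<^sup>2 + (s * sin \<alpha>)\<^sup>2 = s\<^sup>2 * ((cos \<alpha>)\<^sup>2 + (sin \<alpha>)\<^sup>2)"
    by (simp only: power_mult_distrib distrib_left)
  also have "\<dots> = s\<^sup>2"
    by simp
  finally have dC: "dist A C = s"
    using s by (simp add: dist_vec_def L2_set_def UNIV_2 dist_real_def)
  have area: "measure lborel (convex hull {A, B, C}) = m"
  proof -
    have "\<bar>(C$1 - A$1) * (B$2 - A$2) - (B$1 - A$1) * (C$2 - A$2)\<bar> = q * sin \<alpha> * (s * s)"
      using assms s(1) sa by (simp add: abs_mult)
    also have "\<dots> = 2 * m"
      unfolding s(2) using assms sa by simp
    finally have eq: "\<bar>(C$1 - A$1) * (B$2 - A$2) - (B$1 - A$1) * (C$2 - A$2)\<bar> = 2 * m" .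
    show ?thesis
      unfolding content_triangle eq by simp
  qed
  have "\<not> collinear {A, B, C}"
  proof
    assume "collinear {A, B, C}"
    then have "B = 0 \<or> C = 0 \<or> (\<exists>c. C = c *\<^sub>R B)"
      unfolding A_def by (simp only: collinear_lemma)
    then have "B $ 1 = 0 \<or> C $ 2 = 0"
      by (metis \<open>B $ 2 = 0\<close> mult_zero_right real_scaleR_def vector_scaleR_component zero_index)
    then show False
      using assms s sa by auto
  qed
  moreover have "vertex_angle A B C = \<alpha>"
  proof -
    have "(B - A) \<bullet> (C - A) = q * s * (s * cos \<alpha>)"
      by (simp add: inner_vec_def UNIV_2)
    then show ?thesis
      using assms s by (simp add: vertex_angle_def dB dC arccos_cos)
  qed
  moreover have "dist A C \<le> dist A B" "q = dist A B / dist A C"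
    using assms s by (simp_all add: dB dC)
  ultimately show ?thesis
    using area unfolding triangle_angle_ratio_def by blast
qed

end

theory Submission
  imports Defs
begin

text \<open>
  In the affine coordinates \<open>x = A + x\<^sub>1 U + x\<^sub>2 V\<close>, \<open>U = B - A\<close>, \<open>V = C - A\<close>, the energy is an integral of
  \<open>K (\<bar>z\<^sub>1 U + z\<^sub>2 V\<bar>)\<close> against the covariogram \<open>(1 - N z)\<^sub>+\<^sup>2 / 2\<close> of the standard triangle, where \<open>N\<close> is the
  norm whose unit ball is the hexagon with vertices \<open>\<plusminus>e\<^sub>1\<close>, \<open>\<plusminus>e\<^sub>2\<close>, \<open>\<plusminus>(e\<^sub>1 - e\<^sub>2)\<close>. Integrating radially over the
  cones spanned by the edges of that hexagon gives
  \<open>D = 4 m\<^sup>2 (\<Sum>i=1..3. \<integral>s=0..1. \<eta> (Q\<^sub>i q s))\<close>, with \<open>\<bar>U\<bar> \<bar>V\<bar> Q\<^sub>i q s\<close> the squared length of the image of a point on the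
  \<open>i\<close>-th edge and \<open>\<eta> x = \<integral>r=0..1. r (1 - r)\<^sup>2 K (r \<surd>(\<bar>U\<bar> \<bar>V\<bar> x))\<close>. Here \<open>(x \<eta>(x))' = g x\<close> for a strictly
  decreasing \<open>g\<close>. Changing \<open>q\<close> is a flow along \<open>z\<^sub>1 \<partial>\<^sub>1 - z\<^sub>2 \<partial>\<^sub>2\<close>, so integration by parts in \<open>s\<close>
  expresses the \<open>q\<close>-derivative through \<open>g\<close> alone, the boundary terms cancelling:
  \<open>q D' = 4 m\<^sup>2 \<integral>s=0..1. g (Q\<^sub>1 q s) - g (Q\<^sub>2 q s) + (2 s - 1) g (Q\<^sub>3 q s)\<close>.
  For \<open>q > 1\<close> this is negative because \<open>Q\<^sub>1 - Q\<^sub>2 = (q - 1 / q) (1 - s\<^sup>2) > 0\<close> and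
  \<open>Q\<^sub>3 q s - Q\<^sub>3 q (1 - s) = (q - 1 / q) (2 s - 1)\<close>.
\<close>

subsection \<open>The covariogram of the standard triangle\<close>

lemma measurable_fst_snd_borel [measurable]:
  "fst \<in> borel_measurable (borel :: ('a::second_countable_topology \<times> 'b::second_countable_topology) measure)"
  "snd \<in> borel_measurable (borel :: ('a \<times> 'b) measure)"
  by (intro borel_measurable_continuous_onI continuous_intros)+

lemma measurable_Pair_borel [measurable (raw)]:
  fixes f :: "'c \<Rightarrow> 'a::second_countable_topology" and g :: "'c \<Rightarrow> 'b::second_countable_topology"
  assumes "f \<in> borel_measurable M" "g \<in> borel_measurable M"
  shows "(\<lambda>x. (f x, g x)) \<in> borel_measurable M"
  using assms by (simp add: borel_prod[symmetric])

lemma nn_integral_iterated: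
  fixes f :: "real \<times> real \<Rightarrow> ennreal"
  assumes [measurable]: "f \<in> borel_measurable borel"
  shows "(\<integral>\<^sup>+z. f z \<partial>lborel) = (\<integral>\<^sup>+x. (\<integral>\<^sup>+y. f (x, y) \<partial>lborel) \<partial>lborel)"
    and "(\<integral>\<^sup>+z. f z \<partial>lborel) = (\<integral>\<^sup>+y. (\<integral>\<^sup>+x. f (x, y) \<partial>lborel) \<partial>lborel)"
proof -
  have m: "f \<in> borel_measurable (lborel \<Otimes>\<^sub>M lborel)"
    by (simp add: lborel_prod)
  show "(\<integral>\<^sup>+z. f z \<partial>lborel) = (\<integral>\<^sup>+x. (\<integral>\<^sup>+y. f (x, y) \<partial>lborel) \<partial>lborel)"
    using lborel.nn_integral_fst[OF m] by (simp add: lborel_prod)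
  show "(\<integral>\<^sup>+z. f z \<partial>lborel) = (\<integral>\<^sup>+y. (\<integral>\<^sup>+x. f (x, y) \<partial>lborel) \<partial>lborel)"
    using lborel_pair.nn_integral_snd[OF m] by (simp add: lborel_prod)
qed

text \<open>Polar coordinates with the edge \<open>x = 1\<close> in place of the circle: on each
  vertical slice the substitution \<open>y = x s\<close> produces the factor \<open>x\<close>, and
  Tonelli then puts the slope \<open>s\<close> outside and the radius \<open>r\<close>
  inside.\<close>

lemma nn_integral_cone:
  fixes f :: "real \<times> real \<Rightarrow> ennreal"
  assumes [measurable]: "f \<in> borel_measurable borel"
  shows "(\<integral>\<^sup>+z. f z * indicator {z. 0 < snd z \<and> snd z \<le> fst z} z \<partial>lborel) =
    (\<integral>\<^sup>+s\<in>{0..1}. (\<integral>\<^sup>+r\<in>{0<..}. ennreal r * f (r, r * s) \<partial>lborel) \<partial>lborel)"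
proof -
  have "(\<integral>\<^sup>+z. f z * indicator {z. 0 < snd z \<and> snd z \<le> fst z} z \<partial>lborel) =
     (\<integral>\<^sup>+x. (\<integral>\<^sup>+y. f (x, y) * indicator {z. 0 < snd z \<and> snd z \<le> fst z} (x, y) \<partial>lborel) \<partial>lborel)"
    by (subst nn_integral_iterated(1)) simp_all
  also have "\<dots> = (\<integral>\<^sup>+x. (\<integral>\<^sup>+s. (ennreal x * f (x, x * s) * indicator {0<..} x) * indicator {0..1} s \<partial>lborel) \<partial>lborel)"
  proof (rule nn_integral_cong)
    fix x :: real
    show "(\<integral>\<^sup>+y. f (x, y) * indicator {z. 0 < snd z \<and> snd z \<le> fst z} (x, y) \<partial>lborel)
      = (\<integral>\<^sup>+s. (ennreal x * f (x, x * s) * indicator {0<..} x) * indicator {0..1} s \<partial>lborel)"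
    proof (cases "x > 0")
      case True
      have "(\<integral>\<^sup>+y. f (x, y) * indicator {z. 0 < snd z \<and> snd z \<le> fst z} (x, y) \<partial>lborel)
        = ennreal x * (\<integral>\<^sup>+s. f (x, x * s) * indicator {z. 0 < snd z \<and> snd z \<le> fst z} (x, x * s) \<partial>lborel)"
        using True by (subst nn_integral_real_affine[where c = x and t = 0]) simp_all
      also have "\<dots> = (\<integral>\<^sup>+s. ennreal x * (f (x, x * s) * indicator {z. 0 < snd z \<and> snd z \<le> fst z} (x, x * s)) \<partial>lborel)"
        by (rule nn_integral_cmult[symmetric]) simp
      also have "\<dots> = (\<integral>\<^sup>+s. (ennreal x * f (x, x * s) * indicator {0<..} x) * indicator {0..1} s \<partial>lborel)"
        using AE_lborel_singleton[of "0::real"]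
        by (intro nn_integral_cong_AE, eventually_elim)
           (use True in \<open>auto simp: indicator_def zero_less_mult_iff mult.assoc\<close>)
      finally show ?thesis .
    next
      case False
      then have "(\<lambda>y. f (x, y) * indicator {z. 0 < snd z \<and> snd z \<le> fst z} (x, y)) = (\<lambda>y. 0)"
        by (auto simp: indicator_def)
      with False show ?thesis
        by simp
    qed
  qed
  also have "\<dots> = (\<integral>\<^sup>+s. (\<integral>\<^sup>+r. (ennreal r * f (r, r * s) * indicator {0<..} r) * indicator {0..1} s \<partial>lborel) \<partial>lborel)"
    by (rule lborel_pair.Fubini'[symmetric]) simp
  also have "\<dots> = (\<integral>\<^sup>+s\<in>{0..1}. (\<integral>\<^sup>+r\<in>{0<..}. ennreal r * f (r, r * s) \<partial>lborel) \<partial>lborel)"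
    by (intro nn_integral_cong nn_integral_multc) simp
  finally show ?thesis .
qed

lemma nn_integral_lborel_reflect:
  fixes f :: "'a::euclidean_space \<Rightarrow> ennreal"
  assumes [measurable]: "f \<in> borel_measurable borel"
  shows "(\<integral>\<^sup>+z. f (a - z) \<partial>lborel) = (\<integral>\<^sup>+z. f z \<partial>lborel)"
  by (subst (2) lborel_affine[of "-1" a]) (simp_all add: nn_integral_density nn_integral_distr)

text \<open>
  The six cones over the edges of the hexagon with vertices \<open>(1,0), (0,1), (-1,1)\<close> and their negatives
  partition the plane minus the origin; opposite cones contribute equally.
\<close>

lemma nn_integral_hexagonal:
  fixes f :: "real \<times> real \<Rightarrow> ennreal"
  assumes [measurable]: "f \<in> borel_measurable borel" and even: "\<And>z. f (- z) = f z"
  shows "(\<integral>\<^sup>+z. f z \<partial>lborel) =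
     2 * (\<integral>\<^sup>+s\<in>{0..1}. (\<integral>\<^sup>+r\<in>{0<..}. ennreal r * f (r, - (r * s)) \<partial>lborel) \<partial>lborel)
   + 2 * (\<integral>\<^sup>+s\<in>{0..1}. (\<integral>\<^sup>+r\<in>{0<..}. ennreal r * f (r * s, r - r * s) \<partial>lborel) \<partial>lborel)
   + 2 * (\<integral>\<^sup>+s\<in>{0..1}. (\<integral>\<^sup>+r\<in>{0<..}. ennreal r * f (r * s - r, r) \<partial>lborel) \<partial>lborel)"
proof -
  define C where "C = {z::real\<times>real. 0 < snd z \<and> snd z \<le> fst z}"
  have [measurable]: "C \<in> sets borel"
    unfolding C_def by measurable
  \<comment> \<open>Each indicator pulls \<open>C\<close> back along a linear map of determinant -1,
    which selects one cone from each opposite pair. Since \<open>C\<close> contains its side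
    \<open>y = x\<close> but not its side \<open>y = 0\<close>, every bounding ray belongs to
    exactly one of the six cones.\<close>
  define p1 p2 p3 :: "real \<times> real \<Rightarrow> ennreal"
    where "p1 z = f z * indicator C (fst z, - snd z)"
      and "p2 z = f z * indicator C (fst z + snd z, fst z)"
      and "p3 z = f z * indicator C (snd z, fst z + snd z)" for z
  have [measurable]: "p1 \<in> borel_measurable borel" "p2 \<in> borel_measurable borel" "p3 \<in> borel_measurable borel"
    unfolding p1_def[abs_def] p2_def[abs_def] p3_def[abs_def] by measurable
  have "(\<integral>\<^sup>+z. f z \<partial>lborel) = (\<integral>\<^sup>+z. p1 z + p1 (- z) + (p2 z + p2 (- z)) + (p3 z + p3 (- z)) \<partial>lborel)"
    using AE_lborel_singleton[of "(0, 0) :: real \<times> real"]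
    by (intro nn_integral_cong_AE, eventually_elim)
       (auto simp: p1_def p2_def p3_def even indicator_def C_def)
  also have "\<dots> = 2 * (\<integral>\<^sup>+z. p1 z \<partial>lborel) + 2 * (\<integral>\<^sup>+z. p2 z \<partial>lborel) + 2 * (\<integral>\<^sup>+z. p3 z \<partial>lborel)"
    using nn_integral_lborel_reflect[of p1 0] nn_integral_lborel_reflect[of p2 0] nn_integral_lborel_reflect[of p3 0]
    by (simp add: nn_integral_add mult_2)
  also have "(\<integral>\<^sup>+z. p1 z \<partial>lborel) = (\<integral>\<^sup>+z. f (fst z, - snd z) * indicator C z \<partial>lborel)"
    by (simp add: nn_integral_iterated(1) p1_def
        nn_integral_lborel_reflect[of "\<lambda>y. f (x, y) * indicator C (x, - y)" 0 for x, symmetric])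
  also have "\<dots> = (\<integral>\<^sup>+s\<in>{0..1}. (\<integral>\<^sup>+r\<in>{0<..}. ennreal r * f (r, - (r * s)) \<partial>lborel) \<partial>lborel)"
    unfolding C_def by (subst nn_integral_cone) simp_all
  \<comment> \<open>The linear map is split into a shear, which for fixed \<open>x\<close> is a
    translation in \<open>y\<close>, and an exchange of coordinates, which is absorbed by iterating
    the two integrals in different orders.\<close>
  also have "(\<integral>\<^sup>+z. p2 z \<partial>lborel) = (\<integral>\<^sup>+z. f (snd z, fst z - snd z) * indicator C z \<partial>lborel)"
  proof -
    have "(\<integral>\<^sup>+y. p2 (x, y) \<partial>lborel) = (\<integral>\<^sup>+y. p2 (x, y - x) \<partial>lborel)" for x
      using nn_integral_real_affine[of "\<lambda>y. p2 (x, y)" 1 "- x"] by simp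
    then show ?thesis
      by (subst (1) nn_integral_iterated(1), simp, subst nn_integral_iterated(2), simp)
         (simp add: p2_def)
  qed
  also have "\<dots> = (\<integral>\<^sup>+s\<in>{0..1}. (\<integral>\<^sup>+r\<in>{0<..}. ennreal r * f (r * s, r - r * s) \<partial>lborel) \<partial>lborel)"
    unfolding C_def by (subst nn_integral_cone) simp_all
  also have "(\<integral>\<^sup>+z. p3 z \<partial>lborel) = (\<integral>\<^sup>+z. f (snd z - fst z, fst z) * indicator C z \<partial>lborel)"
  proof -
    have "(\<integral>\<^sup>+x. p3 (x, y) \<partial>lborel) = (\<integral>\<^sup>+x. p3 (x - y, y) \<partial>lborel)" for y
      using nn_integral_real_affine[of "\<lambda>x. p3 (x, y)" 1 "- y"] by simp
    then show ?thesis
      by (subst (1) nn_integral_iterated(2), simp, subst nn_integral_iterated(1), simp)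
         (simp add: p3_def)
  qed
  also have "\<dots> = (\<integral>\<^sup>+s\<in>{0..1}. (\<integral>\<^sup>+r\<in>{0<..}. ennreal r * f (r * s - r, r) \<partial>lborel) \<partial>lborel)"
    unfolding C_def by (subst nn_integral_cone) simp_all
  finally show ?thesis .
qed

section \<open>Overlap of the standard triangle with its translates\<close>

definition std_triangle :: "(real \<times> real) set"
  where "std_triangle = {p. 0 \<le> fst p \<and> 0 \<le> snd p \<and> fst p + snd p \<le> 1}"

lemma std_triangle_measurable [measurable]: "std_triangle \<in> sets borel"
  unfolding std_triangle_def by measurable

text \<open>This is half the l1 norm of \<open>(z1, z2, - z1 - z2)\<close>, a displacement in
  barycentric coordinates, and it is the gauge of the difference body of
  \<open>std_triangle\<close>.\<close>

definition hexagonal_norm :: "real \<times> real \<Rightarrow> real"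
  where "hexagonal_norm z = max 0 (fst z) + max 0 (snd z) + max 0 (- fst z - snd z)"

lemma hexagonal_norm_measurable [measurable]: "hexagonal_norm \<in> borel_measurable borel"
  unfolding hexagonal_norm_def[abs_def] by measurable

lemma hexagonal_norm_uminus: "hexagonal_norm (- z) = hexagonal_norm z"
  by (simp add: hexagonal_norm_def max_def)

lemma nn_integral_right_triangle:
  fixes a b t :: real
  assumes "t \<ge> 0"
  shows "(\<integral>\<^sup>+p. indicator {p. a \<le> fst p \<and> b \<le> snd p \<and> fst p + snd p \<le> a + b + t} p \<partial>lborel)
    = ennreal (t\<^sup>2 / 2)"
proof -
  let ?T = "{p. a \<le> fst p \<and> b \<le> snd p \<and> fst p + snd p \<le> a + b + t}"
  have [measurable]: "?T \<in> sets borel" by measurable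
  have "(\<integral>\<^sup>+p. indicator ?T p \<partial>lborel) = (\<integral>\<^sup>+x. (\<integral>\<^sup>+y. indicator ?T (x, y) \<partial>lborel) \<partial>lborel)"
    by (rule nn_integral_iterated(1)) simp
  also have "\<dots> = (\<integral>\<^sup>+x. ennreal (a + t - x) * indicator {a..a + t} x \<partial>lborel)"
  proof (rule nn_integral_cong)
    fix x :: real
    have "(\<integral>\<^sup>+y. indicator ?T (x, y) \<partial>lborel)
      = (\<integral>\<^sup>+y. indicator {b..a + b + t - x} y * indicator {a..a + t} x \<partial>lborel)"
      by (rule nn_integral_cong) (auto simp: indicator_def)
    also have "\<dots> = ennreal (a + t - x) * indicator {a..a + t} x"
      by (cases "x \<in> {a..a + t}") (simp_all add: nn_integral_multc algebra_simps)
    finally show "(\<integral>\<^sup>+y. indicator ?T (x, y) \<partial>lborel) = ennreal (a + t - x) * indicator {a..a + t} x" .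
  qed
  also have "\<dots> = ennreal (- ((t - t)\<^sup>2 / 2) - - ((t - 0)\<^sup>2 / 2))"
  proof -
    have "(\<integral>\<^sup>+x. ennreal (a + t - x) * indicator {a..a + t} x \<partial>lborel)
       = ennreal (- ((a + t - (a + t))\<^sup>2 / 2) - - ((a + t - a)\<^sup>2 / 2))"
      using assms by (intro nn_integral_FTC_Icc) (auto intro!: derivative_eq_intros simp: field_simps)
    then show ?thesis by simp
  qed
  finally show ?thesis by simp
qed

text \<open>The intersection of the triangle with its translate by \<open>z\<close> has sides in the
  same three directions, so it is a homothetic copy with leg \<open>1 - hexagonal_norm z\<close>, or
  empty if this is negative. Its area is half the squared leg.\<close>

lemma std_triangle_covariogram:
  "(\<integral>\<^sup>+p. indicator std_triangle p * indicator std_triangle (p - z) \<partial>lborel)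
    = ennreal ((max 0 (1 - hexagonal_norm z))\<^sup>2 / 2)"
proof -
  let ?T = "{p. max 0 (fst z) \<le> fst p \<and> max 0 (snd z) \<le> snd p \<and>
     fst p + snd p \<le> max 0 (fst z) + max 0 (snd z) + (1 - hexagonal_norm z)}"
  have *: "indicator std_triangle p * indicator std_triangle (p - z) = (indicator ?T p :: ennreal)" for p
    by (auto simp: indicator_def std_triangle_def hexagonal_norm_def max_def split: if_splits)
  show ?thesis
  proof (cases "hexagonal_norm z \<le> 1")
    case True
    then show ?thesis
      unfolding * by (subst nn_integral_right_triangle) (auto simp: max_def)
  next
    case False
    then have "?T = {}" by auto
    with False show ?thesis
      unfolding * by (simp add: max_def)
  qed
qed

text \<open>With \<open>z = p - p'\<close> the double integral becomes that of \<open>h\<close>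
  against the covariogram. In each cone the radius \<open>r\<close> equals
  \<open>hexagonal_norm z\<close>, so the weight depends on \<open>r\<close> alone and is cut off at
  \<open>r = 1\<close>; the factor 2 from opposite cones cancels the \<open>1 / 2\<close> in the
  covariogram.\<close>

lemma nn_integral_std_triangle_pairs:
  fixes h :: "real \<times> real \<Rightarrow> ennreal"
  assumes [measurable]: "h \<in> borel_measurable borel" and even: "\<And>z. h (- z) = h z"
  shows "(\<integral>\<^sup>+p\<in>std_triangle. (\<integral>\<^sup>+p'\<in>std_triangle. h (p - p') \<partial>lborel) \<partial>lborel) =
     (\<integral>\<^sup>+s\<in>{0..1}. (\<integral>\<^sup>+r\<in>{0..1}. ennreal (r * (1 - r)\<^sup>2) * h (r, - (r * s)) \<partial>lborel) \<partial>lborel)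
   + (\<integral>\<^sup>+s\<in>{0..1}. (\<integral>\<^sup>+r\<in>{0..1}. ennreal (r * (1 - r)\<^sup>2) * h (r * s, r - r * s) \<partial>lborel) \<partial>lborel)
   + (\<integral>\<^sup>+s\<in>{0..1}. (\<integral>\<^sup>+r\<in>{0..1}. ennreal (r * (1 - r)\<^sup>2) * h (r * s - r, r) \<partial>lborel) \<partial>lborel)"
proof -
  let ?S = "indicator std_triangle :: real \<times> real \<Rightarrow> ennreal"
  define w where "w z = ennreal ((max 0 (1 - hexagonal_norm z))\<^sup>2 / 2)" for z
  have [measurable]: "w \<in> borel_measurable borel"
    unfolding w_def[abs_def] by measurable
  have "(\<integral>\<^sup>+p\<in>std_triangle. (\<integral>\<^sup>+p'\<in>std_triangle. h (p - p') \<partial>lborel) \<partial>lborel)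
    = (\<integral>\<^sup>+p. (\<integral>\<^sup>+z. h z * (?S p * ?S (p - z)) \<partial>lborel) \<partial>lborel)"
  proof (rule nn_integral_cong)
    fix p
    have "(\<integral>\<^sup>+p'. h (p - p') * ?S p' \<partial>lborel) = (\<integral>\<^sup>+z. h z * ?S (p - z) \<partial>lborel)"
      using nn_integral_lborel_reflect[of "\<lambda>z. h z * ?S (p - z)" p] by simp
    then show "(\<integral>\<^sup>+p'. h (p - p') * ?S p' \<partial>lborel) * ?S p = (\<integral>\<^sup>+z. h z * (?S p * ?S (p - z)) \<partial>lborel)"
      by (subst mult.left_commute, subst nn_integral_cmult) (auto simp: mult.commute)
  qed
  also have "\<dots> = (\<integral>\<^sup>+z. (\<integral>\<^sup>+p. h z * (?S p * ?S (p - z)) \<partial>lborel) \<partial>lborel)"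
    by (rule lborel_pair.Fubini') measurable
  also have "\<dots> = (\<integral>\<^sup>+z. h z * w z \<partial>lborel)"
    by (intro nn_integral_cong) (simp add: nn_integral_cmult std_triangle_covariogram w_def)
  also have "\<dots> =
     2 * (\<integral>\<^sup>+s\<in>{0..1}. (\<integral>\<^sup>+r\<in>{0<..}. ennreal r * (h (r, - (r * s)) * w (r, - (r * s))) \<partial>lborel) \<partial>lborel)
   + 2 * (\<integral>\<^sup>+s\<in>{0..1}. (\<integral>\<^sup>+r\<in>{0<..}. ennreal r * (h (r * s, r - r * s) * w (r * s, r - r * s)) \<partial>lborel) \<partial>lborel)
   + 2 * (\<integral>\<^sup>+s\<in>{0..1}. (\<integral>\<^sup>+r\<in>{0<..}. ennreal r * (h (r * s - r, r) * w (r * s - r, r)) \<partial>lborel) \<partial>lborel)"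
    by (rule nn_integral_hexagonal) (simp_all add: even w_def hexagonal_norm_uminus)
  finally have hex: "(\<integral>\<^sup>+p\<in>std_triangle. (\<integral>\<^sup>+p'\<in>std_triangle. h (p - p') \<partial>lborel) \<partial>lborel) =
     2 * (\<integral>\<^sup>+s\<in>{0..1}. (\<integral>\<^sup>+r\<in>{0<..}. ennreal r * (h (r, - (r * s)) * w (r, - (r * s))) \<partial>lborel) \<partial>lborel)
   + 2 * (\<integral>\<^sup>+s\<in>{0..1}. (\<integral>\<^sup>+r\<in>{0<..}. ennreal r * (h (r * s, r - r * s) * w (r * s, r - r * s)) \<partial>lborel) \<partial>lborel)
   + 2 * (\<integral>\<^sup>+s\<in>{0..1}. (\<integral>\<^sup>+r\<in>{0<..}. ennreal r * (h (r * s - r, r) * w (r * s - r, r)) \<partial>lborel) \<partial>lborel)" .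
  \<comment> \<open>The three cones are treated at once: a parametrization \<open>e\<close> enters
    only through its norm and its measurability, the latter stated for arbitrary \<open>f\<close>
    and \<open>g\<close> so that it can be used under composition.\<close>
  have "2 * (\<integral>\<^sup>+s\<in>{0..1}. (\<integral>\<^sup>+r\<in>{0<..}. ennreal r * (h (e r s) * w (e r s)) \<partial>lborel) \<partial>lborel)
     = (\<integral>\<^sup>+s\<in>{0..1}. (\<integral>\<^sup>+r\<in>{0..1}. ennreal (r * (1 - r)\<^sup>2) * h (e r s) \<partial>lborel) \<partial>lborel)"
    if e: "\<And>r s. 0 < r \<Longrightarrow> 0 \<le> s \<Longrightarrow> s \<le> 1 \<Longrightarrow> hexagonal_norm (e r s) = r"
      and [measurable (raw)]: "\<And>M f g. f \<in> borel_measurable M \<Longrightarrow> g \<in> borel_measurable M \<Longrightarrow>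
        (\<lambda>x::real \<times> real. e (f x) (g x)) \<in> borel_measurable M"
    for e :: "real \<Rightarrow> real \<Rightarrow> real \<times> real"
  proof -
    have [measurable]: "(\<lambda>r. e r s) \<in> borel_measurable borel" for s
      using measurable_compose[OF _ that(2)[of fst borel snd], of "\<lambda>r. (r, s)" borel] by simp
    have "2 * (\<integral>\<^sup>+s\<in>{0..1}. (\<integral>\<^sup>+r\<in>{0<..}. ennreal r * (h (e r s) * w (e r s)) \<partial>lborel) \<partial>lborel)
      = (\<integral>\<^sup>+s\<in>{0..1}. 2 * (\<integral>\<^sup>+r\<in>{0<..}. ennreal r * (h (e r s) * w (e r s)) \<partial>lborel) \<partial>lborel)"
      by (subst mult.assoc, rule nn_integral_cmult[symmetric]) measurable
    also have "\<dots> = (\<integral>\<^sup>+s\<in>{0..1}. (\<integral>\<^sup>+r\<in>{0..1}. ennreal (r * (1 - r)\<^sup>2) * h (e r s) \<partial>lborel) \<partial>lborel)"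
    proof (rule nn_integral_cong)
      fix s :: real
      have "2 * (\<integral>\<^sup>+r\<in>{0<..}. ennreal r * (h (e r s) * w (e r s)) \<partial>lborel)
          = (\<integral>\<^sup>+r\<in>{0..1}. ennreal (r * (1 - r)\<^sup>2) * h (e r s) \<partial>lborel)" if s: "s \<in> {0..1}"
      proof -
        have "2 * (\<integral>\<^sup>+r\<in>{0<..}. ennreal r * (h (e r s) * w (e r s)) \<partial>lborel)
          = (\<integral>\<^sup>+r. 2 * (ennreal r * (h (e r s) * w (e r s)) * indicator {0<..} r) \<partial>lborel)"
          by (rule nn_integral_cmult[symmetric]) simp
        also have "\<dots> = (\<integral>\<^sup>+r\<in>{0..1}. ennreal (r * (1 - r)\<^sup>2) * h (e r s) \<partial>lborel)"
        proof (rule nn_integral_cong)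
          fix r :: real
          have "2 * (ennreal r * w (e r s)) = ennreal (r * (max 0 (1 - r))\<^sup>2)" if "r > 0"
            using that s e[of r s] by (simp add: w_def flip: ennreal_mult' ennreal_numeral)
          then have "h (e r s) * (2 * (ennreal r * w (e r s))) * indicator {0<..} r =
             ennreal (r * (1 - r)\<^sup>2) * h (e r s) * indicator {0..1} r"
            by (cases "0 < r \<and> r \<le> 1") (auto simp: indicator_def max_def mult.commute simp del: mult.assoc)
          then show "2 * (ennreal r * (h (e r s) * w (e r s)) * indicator {0<..} r) =
             ennreal (r * (1 - r)\<^sup>2) * h (e r s) * indicator {0..1} r"
            by (simp add: mult_ac)
        qed
        finally show ?thesis .
      qed
      then show "2 * (\<integral>\<^sup>+r\<in>{0<..}. ennreal r * (h (e r s) * w (e r s)) \<partial>lborel) * indicator {0..1} s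
         = (\<integral>\<^sup>+r\<in>{0..1}. ennreal (r * (1 - r)\<^sup>2) * h (e r s) \<partial>lborel) * indicator {0..1} s"
        by (auto simp: indicator_def)
    qed
    finally show ?thesis .
  qed
  note edge = this
  have "hexagonal_norm (r, - (r * s)) = r" "hexagonal_norm (r * s, r - r * s) = r" "hexagonal_norm (r * s - r, r) = r"
    if "0 < r" "0 \<le> s" "s \<le> 1" for r s
    using that mult_left_mono[of s 1 r] mult_nonneg_nonneg[of r s] by (auto simp: hexagonal_norm_def max_def mult_le_0_iff)
  then show ?thesis
    unfolding hex
    by (subst edge[of "\<lambda>r s. (r, - (r * s))"], simp, simp, subst edge[of "\<lambda>r s. (r * s, r - r * s)"], simp, simp,
        subst edge[of "\<lambda>r s. (r * s - r, r)"]) simp_all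
qed

subsection \<open>The radial kernels\<close>

lemma set_integral_unit_rescale:
  fixes F :: "real \<Rightarrow> real"
  assumes "y > 0" and F: "set_integrable lborel {0..y} F"
  shows "set_integrable lborel {0..1} (\<lambda>r. F (r * y))"
    and "(LINT r:{0..1}|lborel. F (r * y)) = (LINT \<rho>:{0..y}|lborel. F \<rho>) / y"
proof -
  have ind: "indicator {0..1} r = (indicator {0..y} (y * r) :: real)" for r
    using assms by (auto simp: indicator_def mult_le_cancel_left1 zero_le_mult_iff)
  show "set_integrable lborel {0..1} (\<lambda>r. F (r * y))"
    using lborel_integrable_real_affine[OF F[unfolded set_integrable_def], of y 0] assms
    by (simp add: set_integrable_def ind mult.commute)
  show "(LINT r:{0..1}|lborel. F (r * y)) = (LINT \<rho>:{0..y}|lborel. F \<rho>) / y"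
    unfolding set_lebesgue_integral_def
    using lborel_integral_real_affine[of y "\<lambda>x. indicator {0..y} x *\<^sub>R F x" 0] assms
    by (simp add: ind mult.commute)
qed

lemma set_integrable_moment:
  fixes K :: "real \<Rightarrow> real"
  assumes "set_integrable lborel {0..y} (\<lambda>\<rho>. \<rho> * K \<rho>)"
  shows "set_integrable lborel {0..y} (\<lambda>\<rho>. \<rho> ^ Suc n * K \<rho>)"
proof (rule set_integrable_bound)
  show "set_integrable lborel {0..y} (\<lambda>\<rho>. y ^ n * (\<rho> * K \<rho>))"
    by (rule set_integrable_mult_right) (rule assms)
  \<comment> \<open>Measurability is taken from the integrable product with the indicator, since
    nothing is assumed here of \<open>K\<close> alone.\<close>
  have "(\<lambda>\<rho>. \<rho> ^ n *\<^sub>R (indicator {0..y} \<rho> *\<^sub>R (\<rho> * K \<rho>))) \<in> borel_measurable lborel"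
    using assms by (intro borel_measurable_scaleR borel_measurable_integrable[of _ "\<lambda>\<rho>. indicator {0..y} \<rho> *\<^sub>R (\<rho> * K \<rho>)"])
      (simp_all add: set_integrable_def)
  then show "set_borel_measurable lborel {0..y} (\<lambda>\<rho>. \<rho> ^ Suc n * K \<rho>)"
    by (simp add: set_borel_measurable_def mult_ac)
  show "AE \<rho> in lborel. \<rho> \<in> {0..y} \<longrightarrow> norm (\<rho> ^ Suc n * K \<rho>) \<le> norm (y ^ n * (\<rho> * K \<rho>))"
    by (auto simp: abs_mult mult_ac intro!: always_eventually mult_left_mono power_mono)
qed

text \<open>Putting \<open>\<rho> = r y\<close> and expanding the polynomial weights turns both
  kernels into moments \<open>I n y\<close> divided by powers of \<open>y\<close>. The parameter
  then sits in an upper limit and in explicit powers, so that differentiating in \<open>y\<close>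
  does not differentiate \<open>K\<close>.\<close>

lemma
  fixes K :: "real \<Rightarrow> real"
  assumes int: "\<And>y. y > 0 \<Longrightarrow> set_integrable lborel {0..y} (\<lambda>\<rho>. \<rho> * K \<rho>)" and y: "y > 0"
  defines "I \<equiv> \<lambda>n y. LINT \<rho>:{0..y}|lborel. \<rho> ^ n * K \<rho>"
  shows set_integrable_edge_kernel: "set_integrable lborel {0..1} (\<lambda>r. r * (1 - r)\<^sup>2 * K (r * y))"
    and edge_kernel_eq: "(LINT r:{0..1}|lborel. r * (1 - r)\<^sup>2 * K (r * y)) = I 1 y / y\<^sup>2 - 2 * I 2 y / y ^ 3 + I 3 y / y ^ 4"
    and set_integrable_dual_kernel: "set_integrable lborel {0..1} (\<lambda>r. r\<^sup>2 * (1 - r) * K (r * y))"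
    and dual_kernel_eq: "(LINT r:{0..1}|lborel. r\<^sup>2 * (1 - r) * K (r * y)) = I 2 y / y ^ 3 - I 3 y / y ^ 4"
proof -
  note m = set_integrable_moment[OF int[OF y]]
  have m': "set_integrable lborel {0..y} (\<lambda>\<rho>. a * (\<rho> ^ 1 * K \<rho>))"
    "set_integrable lborel {0..y} (\<lambda>\<rho>. a * (\<rho> ^ 2 * K \<rho>))"
    "set_integrable lborel {0..y} (\<lambda>\<rho>. a * (\<rho> ^ 3 * K \<rho>))" for a
    using m[of 0] m[of 1] m[of 2] by (auto simp: numeral_3_eq_3 numeral_2_eq_2)
  define F where "F \<rho> = 1 / y * (\<rho> ^ 1 * K \<rho>) - 2 / y\<^sup>2 * (\<rho> ^ 2 * K \<rho>) + 1 / y ^ 3 * (\<rho> ^ 3 * K \<rho>)" for \<rho>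
  define G where "G \<rho> = 1 / y\<^sup>2 * (\<rho> ^ 2 * K \<rho>) - 1 / y ^ 3 * (\<rho> ^ 3 * K \<rho>)" for \<rho>
  have F: "set_integrable lborel {0..y} F" and G: "set_integrable lborel {0..y} G"
    unfolding F_def[abs_def] G_def[abs_def] by (intro set_integral_add set_integral_diff m')+
  have *: "r * (1 - r)\<^sup>2 * K (r * y) = F (r * y)" "r\<^sup>2 * (1 - r) * K (r * y) = G (r * y)" for r
    using y unfolding F_def G_def by (simp_all add: field_simps power2_eq_square power3_eq_cube)
  show "set_integrable lborel {0..1} (\<lambda>r. r * (1 - r)\<^sup>2 * K (r * y))"
    "set_integrable lborel {0..1} (\<lambda>r. r\<^sup>2 * (1 - r) * K (r * y))"
    unfolding * by (rule set_integral_unit_rescale(1)[OF y], rule F G)+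
  have "(LINT \<rho>:{0..y}|lborel. F \<rho>) = 1 / y * I 1 y - 2 / y\<^sup>2 * I 2 y + 1 / y ^ 3 * I 3 y"
    unfolding F_def I_def by (simp only: m' set_integral_add set_integral_diff set_integral_mult_right)
  then show "(LINT r:{0..1}|lborel. r * (1 - r)\<^sup>2 * K (r * y)) = I 1 y / y\<^sup>2 - 2 * I 2 y / y ^ 3 + I 3 y / y ^ 4"
    unfolding * set_integral_unit_rescale(2)[OF y F] using y by (simp add: field_simps eval_nat_numeral)
  have "(LINT \<rho>:{0..y}|lborel. G \<rho>) = 1 / y\<^sup>2 * I 2 y - 1 / y ^ 3 * I 3 y"
    unfolding G_def I_def by (simp only: m' set_integral_add set_integral_diff set_integral_mult_right)
  then show "(LINT r:{0..1}|lborel. r\<^sup>2 * (1 - r) * K (r * y)) = I 2 y / y ^ 3 - I 3 y / y ^ 4"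
    unfolding * set_integral_unit_rescale(2)[OF y G] using y by (simp add: field_simps eval_nat_numeral)
qed

text \<open>The integrand may be unbounded near 0, so the fundamental theorem of calculus is used in
  its pointwise form, which asks for integrability on an interval and continuity at
  \<open>y\<close>.\<close>

lemma DERIV_moment:
  fixes K :: "real \<Rightarrow> real"
  assumes int: "\<And>y. y > 0 \<Longrightarrow> set_integrable lborel {0..y} (\<lambda>\<rho>. \<rho> * K \<rho>)"
    and cont: "continuous_on {0<..} K" and "y > 0"
  shows "((\<lambda>y. LINT \<rho>:{0..y}|lborel. \<rho> ^ Suc n * K \<rho>) has_real_derivative y ^ Suc n * K y) (at y)"
proof -
  let ?f = "\<lambda>\<rho>. \<rho> ^ Suc n * K \<rho>"
  have f: "set_integrable lborel {0..y} ?f" if "y > 0" for y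
    by (rule set_integrable_moment[OF int[OF that]])
  have "continuous (at y) K"
    using cont \<open>y > 0\<close> by (simp add: continuous_on_eq_continuous_at)
  then have "continuous (at y) ?f"
    by (intro continuous_intros)
  \<comment> \<open>The right end \<open>2 * y\<close> makes \<open>y\<close> an interior point, so
    that the filter within the interval is \<open>at y\<close>. The set of exceptional points is
    empty.\<close>
  then have c: "continuous (at y within ({0..2 * y} - {})) ?f"
    by (rule continuous_at_imp_continuous_within)
  have "((\<lambda>u. integral {0..u} ?f) has_vector_derivative ?f y) (at y within {0..2 * y} - {})"
    using \<open>y > 0\<close> set_borel_integral_eq_integral(1)[OF f[of "2 * y"]]
    by (intro integral_has_vector_derivative_continuous_at c) auto
  moreover have "at y within {0..2 * y} - {} = at y"
    using \<open>y > 0\<close> by (simp add: at_within_Icc_at)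
  ultimately have "((\<lambda>u. integral {0..u} ?f) has_vector_derivative ?f y) (at y)"
    by metis
  then have *: "((\<lambda>u. integral {0..u} ?f) has_real_derivative ?f y) (at y)"
    by (simp add: has_real_derivative_iff_has_vector_derivative)
  show ?thesis
    by (rule has_field_derivative_transform_within_open[OF *, of "{0<..}"])
       (use \<open>y > 0\<close> in \<open>simp_all add: set_borel_integral_eq_integral(2)[OF f] del: power_Suc\<close>)
qed

text \<open>The difference of the integrands is positive on the open unit interval. If its integral
  were 0 it would vanish almost everywhere, and that interval would be a null set.\<close>

lemma dual_kernel_strict_antimono:
  fixes K :: "real \<Rightarrow> real"
  assumes int: "\<And>y. y > 0 \<Longrightarrow> set_integrable lborel {0..y} (\<lambda>\<rho>. \<rho> * K \<rho>)"
    and anti: "strict_antimono_on {0<..} K" and "0 < y" "y < y'"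
  shows "(LINT r:{0..1}|lborel. r\<^sup>2 * (1 - r) * K (r * y')) < (LINT r:{0..1}|lborel. r\<^sup>2 * (1 - r) * K (r * y))"
proof -
  let ?d = "\<lambda>r. r\<^sup>2 * (1 - r) * K (r * y) - r\<^sup>2 * (1 - r) * K (r * y')"
  have i: "set_integrable lborel {0..1} (\<lambda>r. r\<^sup>2 * (1 - r) * K (r * y))"
    "set_integrable lborel {0..1} (\<lambda>r. r\<^sup>2 * (1 - r) * K (r * y'))"
    using assms by (intro set_integrable_dual_kernel; simp)+
  then have d: "set_integrable lborel {0..1} ?d"
    by (rule set_integral_diff)
  have pos: "indicator {0..1} r *\<^sub>R ?d r > 0" if "0 < r" "r < 1" for r
  proof -
    have "K (r * y') < K (r * y)"
      using that assms by (auto simp: monotone_on_def)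
    then show ?thesis using that by simp
  qed
  \<comment> \<open>At the two endpoints the weight vanishes, so the value of \<open>K\<close> at 0
    does not enter.\<close>
  have nonneg: "indicator {0..1} r *\<^sub>R ?d r \<ge> 0" for r
    using pos[of r] by (cases "r \<in> {0, 1}") (auto simp: indicator_def split: if_splits)
  have "(LINT r:{0..1}|lborel. ?d r) \<noteq> 0"
  proof
    assume "(LINT r:{0..1}|lborel. ?d r) = 0"
    then have "AE r in lborel. indicator {0..1} r *\<^sub>R ?d r = 0"
      using d nonneg by (subst (asm) set_lebesgue_integral_def, subst (asm) integral_nonneg_eq_0_iff_AE)
        (auto simp: set_integrable_def)
    then have "AE r in lborel. r \<notin> {0<..<1::real}"
      by eventually_elim (use pos in force)
    then have "emeasure lborel {0<..<1::real} = 0"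
      by (subst (asm) AE_iff_measurable[OF _ refl]) (auto simp: greaterThanLessThan_def greaterThan_def lessThan_def Int_def)
    then show False by simp
  qed
  moreover have "(LINT r:{0..1}|lborel. ?d r) \<ge> 0"
    unfolding set_lebesgue_integral_def using nonneg by (intro Bochner_Integration.integral_nonneg)
  ultimately show ?thesis
    using set_integral_diff(2)[OF i] by simp
qed

text \<open>In the variable \<open>y = sqrt (P * x)\<close> the kernels are \<open>E\<close> and
  \<open>G\<close>, and the moment formulas give \<open>E' = 2 (G - E) / y\<close>. Since
  \<open>dy/dx = y / (2 x)\<close>, this is the relation \<open>(x \<eta>)' = g\<close>. The
  monotonicity of \<open>g\<close> is inherited from \<open>K\<close>.\<close>

lemma edge_kernel:
  fixes K :: "real \<Rightarrow> real" and P :: real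
  assumes int: "\<And>y. y > 0 \<Longrightarrow> set_integrable lborel {0..y} (\<lambda>\<rho>. \<rho> * K \<rho>)"
    and cont: "continuous_on {0<..} K" and anti: "strict_antimono_on {0<..} K" and P: "P > 0"
  defines "\<eta> \<equiv> \<lambda>x. LINT r:{0..1}|lborel. r * (1 - r)\<^sup>2 * K (r * sqrt (P * x))"
    and "g \<equiv> \<lambda>x. LINT r:{0..1}|lborel. r\<^sup>2 * (1 - r) * K (r * sqrt (P * x))"
  shows "\<And>x. x > 0 \<Longrightarrow> (\<eta> has_real_derivative (g x - \<eta> x) / x) (at x)"
    and "continuous_on {0<..} g" and "strict_antimono_on {0<..} g"
proof -
  define I where "I n y = (LINT \<rho>:{0..y}|lborel. \<rho> ^ n * K \<rho>)" for n y
  define E G where "E y = I 1 y / y\<^sup>2 - 2 * I 2 y / y ^ 3 + I 3 y / y ^ 4"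
    and "G y = I 2 y / y ^ 3 - I 3 y / y ^ 4" for y
  have s: "sqrt (P * x) > 0" if "x > 0" for x using P that by simp
  have \<eta>: "\<eta> x = E (sqrt (P * x))" and g: "g x = G (sqrt (P * x))" if "x > 0" for x
    unfolding \<eta>_def g_def E_def G_def I_def by (rule edge_kernel_eq dual_kernel_eq, rule int, assumption, rule s[OF that])+
  have dI: "(I 1 has_real_derivative y * K y) (at y)" "(I 2 has_real_derivative y\<^sup>2 * K y) (at y)"
    "(I 3 has_real_derivative y ^ 3 * K y) (at y)" if "y > 0" for y
    using DERIV_moment[OF int cont that, of 0] DERIV_moment[OF int cont that, of 1] DERIV_moment[OF int cont that, of 2]
    by (simp_all add: I_def[abs_def] numeral_3_eq_3 numeral_2_eq_2)
  have quot: "((\<lambda>y. f y / y ^ n) has_real_derivative D / y ^ n - real n * f y / y ^ Suc n) (at y)"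
    if "(f has_real_derivative D) (at y)" "y > 0" for f :: "real \<Rightarrow> real" and D y n
  proof (cases n)
    case 0
    then show ?thesis using that by simp
  next
    case (Suc m)
    have "((\<lambda>y. f y / y ^ n) has_real_derivative (D * y ^ n - f y * (real n * y ^ m)) / (y ^ n * y ^ n)) (at y)"
      using that Suc DERIV_pow[of n y] by (intro DERIV_divide that) (simp_all del: power_Suc)
    also have "(D * y ^ n - f y * (real n * y ^ m)) / (y ^ n * y ^ n) = D / y ^ n - real n * f y / y ^ Suc n"
      using that Suc by (simp add: field_simps)
    finally show ?thesis .
  qed
  have dEf: "(E has_real_derivative 2 * (G y - E y) / y) (at y)" if y: "y > 0" for y
  proof -
    have "((\<lambda>y. I 1 y / y ^ 2 - 2 * (I 2 y / y ^ 3) + I 3 y / y ^ 4) has_real_derivative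
      (y * K y / y ^ 2 - real 2 * I 1 y / y ^ Suc 2) - 2 * (y\<^sup>2 * K y / y ^ 3 - real 3 * I 2 y / y ^ Suc 3)
      + (y ^ 3 * K y / y ^ 4 - real 4 * I 3 y / y ^ Suc 4)) (at y)"
      by (intro DERIV_add DERIV_diff DERIV_cmult quot dI y)
    \<comment> \<open>The terms containing \<open>K y\<close> add up to
      \<open>(1 - 2 + 1) K y / y = 0\<close>, which reflects that the weight of
      \<open>\<eta>\<close> vanishes at \<open>r = 1\<close>.\<close>
    moreover have "(y * K y / y ^ 2 - real 2 * I 1 y / y ^ Suc 2) - 2 * (y\<^sup>2 * K y / y ^ 3 - real 3 * I 2 y / y ^ Suc 3)
      + (y ^ 3 * K y / y ^ 4 - real 4 * I 3 y / y ^ Suc 4) = 2 * (G y - E y) / y"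
      using y unfolding G_def E_def by (simp add: field_simps eval_nat_numeral)
    ultimately show ?thesis
      by (simp add: E_def[abs_def])
  qed
  have dG: "isCont G y" if y: "y > 0" for y
    unfolding G_def[abs_def] using y dI[OF y, THEN DERIV_isCont]
    by (intro isCont_diff isCont_divide isCont_power continuous_ident) auto
  show "(\<eta> has_real_derivative (g x - \<eta> x) / x) (at x)" if x: "x > 0" for x
  proof -
    have ds: "((\<lambda>x. sqrt (P * x)) has_real_derivative sqrt (P * x) / (2 * x)) (at x)"
    proof -
      have "((\<lambda>x. sqrt (P * x)) has_real_derivative inverse (sqrt (P * x)) / 2 * P) (at x)"
        using x P by (intro DERIV_chain2[OF DERIV_real_sqrt]) (auto intro!: derivative_eq_intros)
      also have "inverse (sqrt (P * x)) / 2 * P = sqrt (P * x) / (2 * x)"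
      proof -
        have "sqrt (P * x) * sqrt (P * x) = P * x"
          using x P by simp
        then show ?thesis
          using s[OF x] x by (simp add: divide_simps)
      qed
      finally show ?thesis .
    qed
    have "((\<lambda>x. E (sqrt (P * x))) has_real_derivative
        2 * (G (sqrt (P * x)) - E (sqrt (P * x))) / sqrt (P * x) * (sqrt (P * x) / (2 * x))) (at x)"
      by (rule DERIV_chain2[OF dEf[OF s[OF x]] ds])
    also have "2 * (G (sqrt (P * x)) - E (sqrt (P * x))) / sqrt (P * x) * (sqrt (P * x) / (2 * x)) = (g x - \<eta> x) / x"
      using less_imp_neq[OF s[OF x]] x unfolding \<eta>[OF x] g[OF x] by (simp add: divide_simps)
    finally show ?thesis
      by (rule has_field_derivative_transform_within_open[of _ _ _ "{0<..}"]) (use x in \<open>simp_all add: \<eta>\<close>)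
  qed
  have "continuous_on {0<..} (\<lambda>x. G (sqrt (P * x)))"
    by (rule continuous_on_compose2[of "{0<..}" G]) (auto intro!: continuous_intros continuous_at_imp_continuous_on dG s)
  then show "continuous_on {0<..} g"
    by (rule continuous_on_eq) (simp add: g)
  show "strict_antimono_on {0<..} g"
    using P s unfolding g_def by (intro monotone_onI dual_kernel_strict_antimono[OF int anti]) auto
qed

subsection \<open>Monotonicity in the side ratio\<close>

lemma integral_unit_reflect:
  fixes f :: "real \<Rightarrow> real"
  shows "integral {0..1} (\<lambda>s. f (1 - s)) = integral {0..1} f"
proof -
  have "integral {0..1} (\<lambda>s. f (1 - s)) = integral {-1..-0} (\<lambda>x. f (1 + x))"
    using Henstock_Kurzweil_Integration.integral_reflect_real[where a = "-1" and b = 0 and f = "\<lambda>x. f (1 + x)"] by simp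
  also have "\<dots> = integral {0..1} f"
    using integral_shift_real_ivl[of 0 1 1 f] by (simp add: add.commute)
  finally show ?thesis .
qed

text \<open>All three are values of the quadratic form \<open>q u^2 + v^2 / q + 2 u v c\<close> at
  nonzero vectors. Its determinant is \<open>1 - c^2 > 0\<close>, so completing the square shows
  that it is positive definite.\<close>

lemma edge_length_sq_pos:
  fixes q c s :: real
  assumes "q > 0" "\<bar>c\<bar> < 1"
  shows "q + s\<^sup>2 / q - 2 * s * c > 0" "q * s\<^sup>2 + 1 / q - 2 * s * c > 0"
    "q * s\<^sup>2 + (1 - s)\<^sup>2 / q + 2 * s * (1 - s) * c > 0"
proof -
  have c: "1 - c\<^sup>2 > 0"
    using assms by (simp add: abs_square_less_1)
  have pos: "q * u\<^sup>2 + v\<^sup>2 / q + 2 * u * v * c > 0" if "u \<noteq> 0 \<or> v \<noteq> 0" for u v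
  proof -
    have "q * (q * u\<^sup>2 + v\<^sup>2 / q + 2 * u * v * c) = (v + q * u * c)\<^sup>2 + q\<^sup>2 * u\<^sup>2 * (1 - c\<^sup>2)"
      using assms by (simp add: field_simps power2_eq_square)
    also have "\<dots> > 0"
    proof (cases "u = 0")
      case False
      then have "q\<^sup>2 * u\<^sup>2 * (1 - c\<^sup>2) > 0" using assms c by simp
      then show ?thesis by (smt (verit) zero_le_power2)
    qed (use that in simp)
    finally show ?thesis
      using assms by (simp add: zero_less_mult_iff)
  qed
  show "q + s\<^sup>2 / q - 2 * s * c > 0" using pos[of 1 "- s"] by simp
  show "q * s\<^sup>2 + 1 / q - 2 * s * c > 0" using pos[of s "- 1"] by simp
  show "q * s\<^sup>2 + (1 - s)\<^sup>2 / q + 2 * s * (1 - s) * c > 0"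
    using pos[of s "1 - s"] by simp
qed

text \<open>All that is kept of the kernel is the relation \<open>(x \<eta>)' = g\<close> and the
  strict decrease of \<open>g\<close>. Differentiating in \<open>q\<close> first brings in
  \<open>\<eta>'\<close>; subtracting an exact derivative in \<open>s\<close> leaves only values of
  \<open>g\<close>, whose monotonicity decides the sign.\<close>

lemma edge_integrals_strict_antimono:
  fixes \<eta> g :: "real \<Rightarrow> real" and c :: real
  assumes der: "\<And>x. x > 0 \<Longrightarrow> (\<eta> has_real_derivative (g x - \<eta> x) / x) (at x)"
    and cont: "continuous_on {0<..} g" and anti: "strict_antimono_on {0<..} g" and c: "\<bar>c\<bar> < 1"
  shows "strict_antimono_on {1..} (\<lambda>q. integral {0..1} (\<lambda>s.
     \<eta> (q + s\<^sup>2 / q - 2 * s * c) + \<eta> (q * s\<^sup>2 + 1 / q - 2 * s * c)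
     + \<eta> (q * s\<^sup>2 + (1 - s)\<^sup>2 / q + 2 * s * (1 - s) * c)))"
proof -
  define Q1 Q2 Q3 where Q: "Q1 q s = q + s\<^sup>2 / q - 2 * s * c" "Q2 q s = q * s\<^sup>2 + 1 / q - 2 * s * c"
    "Q3 q s = q * s\<^sup>2 + (1 - s)\<^sup>2 / q + 2 * s * (1 - s) * c" for q s :: real
  define \<zeta> where "\<zeta> x = (g x - \<eta> x) / x" for x
  define D where "D q s = \<zeta> (Q1 q s) * (1 - s\<^sup>2 / q\<^sup>2) + \<zeta> (Q2 q s) * (s\<^sup>2 - 1 / q\<^sup>2)
    + \<zeta> (Q3 q s) * (s\<^sup>2 - (1 - s)\<^sup>2 / q\<^sup>2)" for q s
  define f where "f q s = \<eta> (Q1 q s) + \<eta> (Q2 q s) + \<eta> (Q3 q s)" for q s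
  note Qpos = edge_length_sq_pos[OF _ c, folded Q]
  note der' = der[folded \<zeta>_def]
  have cont_\<eta>: "continuous_on {0<..} \<eta>"
    using der by (auto intro!: continuous_at_imp_continuous_on DERIV_isCont)
  have cont_\<zeta>: "continuous_on {0<..} \<zeta>"
    unfolding \<zeta>_def[abs_def] by (intro continuous_intros cont cont_\<eta>) auto
  note [continuous_intros] = continuous_on_compose2[OF cont_\<eta>] continuous_on_compose2[OF cont_\<zeta>]
    continuous_on_compose2[OF cont]
  have Qs: "continuous_on A (Q1 q)" "continuous_on A (Q2 q)" "continuous_on A (Q3 q)" if "q > 0" for q A
    unfolding Q[abs_def] using that by (auto intro!: continuous_intros)
  have F': "((\<lambda>q. integral {0..1} (f q)) has_real_derivative integral {0..1} (D q)) (at q)" if q: "q > 0" for q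
  proof -
    have "((\<lambda>q. integral (cbox 0 1) (f q)) has_real_derivative integral (cbox 0 1) (D q)) (at q within {0<..})"
    proof (rule leibniz_rule_field_derivative)
      fix q t :: real assume "q \<in> {0<..}"
      then have q: "q > 0" by simp
      show "((\<lambda>q. f q t) has_real_derivative D q t) (at q within {0<..})"
        unfolding f_def D_def
        apply (rule has_field_derivative_at_within)
        apply (intro DERIV_add DERIV_chain2[where f=\<eta>] der' Qpos q)
        using q unfolding Q by (auto intro!: derivative_eq_intros simp: power2_eq_square)
    next
      fix q :: real assume "q \<in> {0<..}"
      then show "f q integrable_on cbox 0 1"
        unfolding f_def[abs_def]
        by (intro integrable_continuous continuous_intros Qs) (auto simp: Qpos)
    next
      show "continuous_on ({0<..} \<times> cbox 0 1) (\<lambda>(q, s). D q s)"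
        unfolding D_def split_beta'
        by (intro continuous_intros) (auto simp: Qpos, auto simp: Q intro!: continuous_intros)
    qed (use q in \<open>auto intro: convex_real_interval\<close>)
    then show ?thesis
      using q by (simp add: at_within_open[of q "{0<..}"])
  qed
  have neg: "integral {0..1} (D q) < 0" if q: "q > 1" for q
  proof -
    \<comment> \<open>In edge coordinates the vector field \<open>z\<^sub>1 \<partial>\<^sub>1 - z\<^sub>2 \<partial>\<^sub>2\<close> has \<open>s\<close>-components \<open>- 2 s\<close>, \<open>2 s\<close> and
      \<open>2 s (1 - s)\<close> on the three edges; half of them are the coefficients of \<open>B\<close>, which agrees at \<open>0\<close> and \<open>1\<close>.\<close>
    define B where "B s = s * (1 - s) * \<eta> (Q3 q s) + s * \<eta> (Q2 q s) - s * \<eta> (Q1 q s)" for s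
    \<comment> \<open>This is the discrepancy between \<open>q * D q s\<close> and the expression in
      \<open>g\<close>. Once it is recognized as the derivative of \<open>B\<close>, the two have
      the same integral over the unit interval.\<close>
    define B' where "B' s = q * D q s - (g (Q1 q s) - g (Q2 q s) + (2 * s - 1) * g (Q3 q s))" for s
    have q0: "q > 0" using q by simp
    have "(B has_vector_derivative B' s) (at s within {0..1})" for s
    proof -
      have "(B has_real_derivative
           (1 - 2 * s) * \<eta> (Q3 q s) + s * (1 - s) * (\<zeta> (Q3 q s) * (2 * q * s - 2 * (1 - s) / q + 2 * (1 - 2 * s) * c))
           + (\<eta> (Q2 q s) + s * (\<zeta> (Q2 q s) * (2 * q * s - 2 * c)))
           - (\<eta> (Q1 q s) + s * (\<zeta> (Q1 q s) * (2 * s / q - 2 * c)))) (at s)"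
      proof -
        have dQ: "(Q1 q has_real_derivative (2 * s / q - 2 * c)) (at s)"
          "(Q2 q has_real_derivative (2 * q * s - 2 * c)) (at s)"
          "(Q3 q has_real_derivative (2 * q * s - 2 * (1 - s) / q + 2 * (1 - 2 * s) * c)) (at s)"
          unfolding Q[abs_def] using q0 by (auto intro!: derivative_eq_intros simp: field_simps)
        note d = DERIV_chain2[OF der'[OF Qpos(1)[OF q0]] dQ(1)] DERIV_chain2[OF der'[OF Qpos(2)[OF q0]] dQ(2)]
          DERIV_chain2[OF der'[OF Qpos(3)[OF q0]] dQ(3)]
        show ?thesis
          unfolding B_def[abs_def]
          by (rule derivative_eq_intros d refl | (simp add: algebra_simps; fail))+
      qed
      also have "(1 - 2 * s) * \<eta> (Q3 q s) + s * (1 - s) * (\<zeta> (Q3 q s) * (2 * q * s - 2 * (1 - s) / q + 2 * (1 - 2 * s) * c))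
           + (\<eta> (Q2 q s) + s * (\<zeta> (Q2 q s) * (2 * q * s - 2 * c)))
           - (\<eta> (Q1 q s) + s * (\<zeta> (Q1 q s) * (2 * s / q - 2 * c))) = B' s"
      proof -
        \<comment> \<open>Eliminating \<open>g\<close> in this way reduces the claim to comparing
          the coefficients of \<open>\<zeta> (Qi q s)\<close> and of \<open>\<eta> (Qi q s)\<close>,
          which are rational in \<open>q\<close> and \<open>s\<close>.\<close>
        have g: "g x = \<zeta> x * x + \<eta> x" if "x > 0" for x
          using that by (simp add: \<zeta>_def)
        note g[OF Qpos(1)[OF q0]] g[OF Qpos(2)[OF q0]] g[OF Qpos(3)[OF q0]]
        then show ?thesis
          using q0 unfolding B'_def D_def
          by (simp, simp add: Q, simp add: field_simps power2_eq_square)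
      qed
      finally show ?thesis
        by (simp add: has_real_derivative_iff_has_vector_derivative has_vector_derivative_at_within)
    qed
    then have "(B' has_integral B 1 - B 0) {0..1}"
      by (intro fundamental_theorem_of_calculus) auto
    \<comment> \<open>At \<open>s = 1\<close> the terms for \<open>Q1\<close> and \<open>Q2\<close>
      cancel because \<open>Q1 q 1 = Q2 q 1\<close>; everything else carries a factor that is 0 at
      the endpoint.\<close>
    moreover have "B 1 - B 0 = 0"
      by (simp add: B_def Q)
    ultimately have B': "B' integrable_on {0..1}" "integral {0..1} B' = 0"
      by (auto simp: integral_unique has_integral_integrable)
    have gi: "continuous_on {0..1} (\<lambda>s. g (Q1 q s))" "continuous_on {0..1} (\<lambda>s. g (Q2 q s))"
       "continuous_on {0..1} (\<lambda>s. g (Q3 q s))" "continuous_on {0..1} (\<lambda>s. g (Q3 q (1 - s)))"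
      by ((rule continuous_intros)+, rule Qs[OF q0], use Qpos[OF q0] in force)+
         (rule continuous_intros continuous_on_compose2[OF Qs(3)[OF q0, of UNIV]] | use Qpos[OF q0] in force)+
    have i: "(\<lambda>s. (2 * s - 1) * g (Q3 q s)) integrable_on {0..1}"
      "(\<lambda>s. (1 - 2 * s) * g (Q3 q (1 - s))) integrable_on {0..1}"
      "(\<lambda>s. g (Q1 q s) - g (Q2 q s)) integrable_on {0..1}"
      by (intro integrable_continuous_real continuous_intros gi)+
    have "q * integral {0..1} (D q) = integral {0..1} (\<lambda>s. B' s + (g (Q1 q s) - g (Q2 q s) + (2 * s - 1) * g (Q3 q s)))"
      by (simp add: B'_def)
    also have "\<dots> = integral {0..1} (\<lambda>s. g (Q1 q s) - g (Q2 q s) + (2 * s - 1) * g (Q3 q s))"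
      using i by (subst integral_add) (auto simp: B' intro!: integrable_add)
    also have "\<dots> = integral {0..1} (\<lambda>s. g (Q1 q s) - g (Q2 q s)) + integral {0..1} (\<lambda>s. (2 * s - 1) * g (Q3 q s))"
      using i by (subst integral_add) auto
    \<comment> \<open>Averaging with the reflection \<open>s\<close> to \<open>1 - s\<close> pairs
      the sign of \<open>2 * s - 1\<close> with a difference of two values of
      \<open>g\<close>.\<close>
    also have "integral {0..1} (\<lambda>s. (2 * s - 1) * g (Q3 q s)) =
        (integral {0..1} (\<lambda>s. (2 * s - 1) * g (Q3 q s)) + integral {0..1} (\<lambda>s. (1 - 2 * s) * g (Q3 q (1 - s)))) / 2"
      using integral_unit_reflect[of "\<lambda>s. (2 * s - 1) * g (Q3 q s)"] by (simp add: algebra_simps)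
    also have "\<dots> = integral {0..1} (\<lambda>s. (2 * s - 1) * (g (Q3 q s) - g (Q3 q (1 - s))) / 2)"
      using i by (subst integral_add[symmetric]) (auto simp: algebra_simps)
    also have "integral {0..1} (\<lambda>s. g (Q1 q s) - g (Q2 q s)) + \<dots>
       = integral {0..1} (\<lambda>s. g (Q1 q s) - g (Q2 q s) + (2 * s - 1) * (g (Q3 q s) - g (Q3 q (1 - s))) / 2)"
      by (intro integral_add[symmetric] integrable_continuous_real continuous_on_add continuous_on_diff
          continuous_on_mult continuous_on_divide continuous_on_const continuous_on_id gi) simp
    also have "\<dots> < integral {0..1} (\<lambda>s::real. 0)"
    proof (rule integral_less_real)
      fix s :: real assume "s \<in> {0<..<1}"
      then have s: "0 < s" "s < 1" by auto
      \<comment> \<open>Strictness comes from the first two edges; the third one contributes a term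
        that is only nonpositive, being 0 at \<open>s = 1 / 2\<close>.\<close>
      have "Q1 q s - Q2 q s = (q - 1 / q) * (1 - s\<^sup>2)"
        using q0 unfolding Q by (simp add: field_simps power2_eq_square)
      moreover have qq: "q - 1 / q > 0"
        using q by (simp add: field_simps less_1_mult)
      moreover have "1 - s\<^sup>2 > 0" using s by (simp add: power_less_one_iff)
      ultimately have "Q2 q s < Q1 q s"
        by (metis diff_gt_0_iff_gt mult_pos_pos)
      then have "g (Q1 q s) < g (Q2 q s)"
        using anti Qpos[OF q0] by (auto simp: monotone_on_def)
      moreover have "(2 * s - 1) * (g (Q3 q s) - g (Q3 q (1 - s))) \<le> 0"
      proof -
        have *: "Q3 q s - Q3 q (1 - s) = (q - 1 / q) * (2 * s - 1)"
          using q0 unfolding Q by (simp add: field_simps power2_eq_square)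
        consider "2 * s - 1 > 0" | "2 * s - 1 = 0" | "2 * s - 1 < 0" by linarith
        then show ?thesis
        proof cases
          case 1
          then have "Q3 q (1 - s) < Q3 q s" using * qq by (metis diff_gt_0_iff_gt mult_pos_pos)
          then have "g (Q3 q s) < g (Q3 q (1 - s))"
            using anti Qpos[OF q0] by (auto simp: monotone_on_def)
          with 1 show ?thesis by (simp add: mult_le_0_iff)
        next
          case 3
          then have "Q3 q s < Q3 q (1 - s)" using * qq by (metis diff_less_0_iff_less mult_pos_neg)
          then have "g (Q3 q (1 - s)) < g (Q3 q s)"
            using anti Qpos[OF q0] by (auto simp: monotone_on_def)
          with 3 show ?thesis by (simp add: mult_le_0_iff)
        qed simp
      qed
      ultimately show "g (Q1 q s) - g (Q2 q s) + (2 * s - 1) * (g (Q3 q s) - g (Q3 q (1 - s))) / 2 < 0"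
        by simp
    qed (auto intro!: continuous_on_add continuous_on_diff continuous_on_mult continuous_on_divide
          continuous_on_const continuous_on_id gi)
    finally show ?thesis
      using q0 by (simp add: mult_less_0_iff)
  qed
  show ?thesis
    unfolding Q[symmetric] f_def[symmetric]
  proof (rule monotone_onI)
    fix p q :: real assume "p \<in> {1..}" "p < q"
    \<comment> \<open>\<open>neg\<close> covers ratios above 1 only. A negative derivative inside
      the interval together with continuity up to its ends suffices, and this includes
      \<open>p = 1\<close>.\<close>
    then show "integral {0..1} (f p) > integral {0..1} (f q)"
      using F' neg
      by (intro DERIV_neg_imp_decreasing_open[of p q "\<lambda>q. integral {0..1} (f q)"])
         (auto intro!: continuous_at_imp_continuous_on DERIV_isCont F'
            exI[of _ "integral {0..1} (D _)"])
  qed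
qed

subsection \<open>The energy of a triangle\<close>

lemma nn_integral_affine_plane_aux:
  fixes f :: "real \<times> real \<Rightarrow> ennreal" and u v :: "real \<times> real"
  assumes [measurable]: "f \<in> borel_measurable borel"
    and u: "fst u \<noteq> 0" and J: "fst u * snd v - snd u * fst v \<noteq> 0"
  shows "(\<integral>\<^sup>+z. f z \<partial>lborel) =
    ennreal \<bar>fst u * snd v - snd u * fst v\<bar> * (\<integral>\<^sup>+p. f (a + fst p *\<^sub>R u + snd p *\<^sub>R v) \<partial>lborel)"
proof -
  obtain u1 u2 v1 v2 a1 a2 where uv: "u = (u1, u2)" "v = (v1, v2)" "a = (a1, a2)"
    by (metis prod.exhaust)
  define d where "d = u1 * v2 - u2 * v1"
  have u1: "u1 \<noteq> 0" and d: "d \<noteq> 0"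
    using u J by (auto simp: uv d_def)
  \<comment> \<open>\<open>k x\<close> is the height above \<open>x\<close> of the line through
    \<open>a\<close> in direction \<open>u\<close>, and \<open>d / u1\<close> is the vertical offset
    caused by one unit of \<open>v\<close>. Thus two one-dimensional affine substitutions suffice,
    with factors \<open>\<bar>d / u1\<bar>\<close> and \<open>\<bar>u1\<bar>\<close> whose product
    is the Jacobian.\<close>
  define k where "k x = a2 + (x - a1) * u2 / u1" for x
  have [measurable]: "k \<in> borel_measurable borel"
    unfolding k_def[abs_def] by measurable
  have "(\<integral>\<^sup>+z. f z \<partial>lborel) = (\<integral>\<^sup>+x. (\<integral>\<^sup>+y. f (x, y) \<partial>lborel) \<partial>lborel)"
    by (rule nn_integral_iterated(1)) simp
  also have "\<dots> = (\<integral>\<^sup>+x. ennreal \<bar>d / u1\<bar> * (\<integral>\<^sup>+b. f (x, k x + d / u1 * b) \<partial>lborel) \<partial>lborel)"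
    using u1 d by (intro nn_integral_cong nn_integral_real_affine) auto
  also have "\<dots> = ennreal \<bar>d / u1\<bar> * (\<integral>\<^sup>+x. (\<integral>\<^sup>+b. f (x, k x + d / u1 * b) \<partial>lborel) \<partial>lborel)"
    by (rule nn_integral_cmult) measurable
  also have "(\<integral>\<^sup>+x. (\<integral>\<^sup>+b. f (x, k x + d / u1 * b) \<partial>lborel) \<partial>lborel)
      = (\<integral>\<^sup>+b. (\<integral>\<^sup>+x. f (x, k x + d / u1 * b) \<partial>lborel) \<partial>lborel)"
    by (rule lborel_pair.Fubini') measurable
  also have "\<dots> = (\<integral>\<^sup>+b. ennreal \<bar>u1\<bar> * (\<integral>\<^sup>+x. f (a + x *\<^sub>R u + b *\<^sub>R v) \<partial>lborel) \<partial>lborel)"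
  proof (rule nn_integral_cong)
    fix b
    have "(\<integral>\<^sup>+x. f (x, k x + d / u1 * b) \<partial>lborel) =
      ennreal \<bar>u1\<bar> * (\<integral>\<^sup>+x. f ((a1 + b * v1) + u1 * x, k ((a1 + b * v1) + u1 * x) + d / u1 * b) \<partial>lborel)"
      using u1 by (intro nn_integral_real_affine) auto
    also have "(\<lambda>x. ((a1 + b * v1) + u1 * x, k ((a1 + b * v1) + u1 * x) + d / u1 * b)) = (\<lambda>x. a + x *\<^sub>R u + b *\<^sub>R v)"
      using u1 by (auto simp: uv k_def d_def field_simps)
    then have "(\<integral>\<^sup>+x. f ((a1 + b * v1) + u1 * x, k ((a1 + b * v1) + u1 * x) + d / u1 * b) \<partial>lborel)
      = (\<integral>\<^sup>+x. f (a + x *\<^sub>R u + b *\<^sub>R v) \<partial>lborel)"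
      by metis
    finally show "(\<integral>\<^sup>+x. f (x, k x + d / u1 * b) \<partial>lborel) =
      ennreal \<bar>u1\<bar> * (\<integral>\<^sup>+x. f (a + x *\<^sub>R u + b *\<^sub>R v) \<partial>lborel)" .
  qed
  also have "\<dots> = ennreal \<bar>u1\<bar> * (\<integral>\<^sup>+b. (\<integral>\<^sup>+x. f (a + x *\<^sub>R u + b *\<^sub>R v) \<partial>lborel) \<partial>lborel)"
    by (rule nn_integral_cmult) (unfold uv, measurable)
  also have "(\<integral>\<^sup>+b. (\<integral>\<^sup>+x. f (a + x *\<^sub>R u + b *\<^sub>R v) \<partial>lborel) \<partial>lborel)
     = (\<integral>\<^sup>+p. f (a + fst p *\<^sub>R u + snd p *\<^sub>R v) \<partial>lborel)"
    by (subst nn_integral_iterated(2)) (unfold uv, simp_all)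
  also have "ennreal \<bar>d / u1\<bar> * (ennreal \<bar>u1\<bar> * X) = ennreal \<bar>fst u * snd v - snd u * fst v\<bar> * X" for X
    using u1 by (simp add: uv d_def mult.assoc[symmetric] ennreal_mult'[symmetric] abs_mult)
  finally show ?thesis .
qed

text \<open>If \<open>u\<close> is vertical then \<open>v\<close> is not, because the determinant is
  nonzero. Exchanging the two vectors changes only the sign of the determinant.\<close>

lemma nn_integral_affine_plane:
  fixes f :: "real \<times> real \<Rightarrow> ennreal" and u v :: "real \<times> real"
  assumes [measurable]: "f \<in> borel_measurable borel"
    and J: "fst u * snd v - snd u * fst v \<noteq> 0"
  shows "(\<integral>\<^sup>+z. f z \<partial>lborel) =
    ennreal \<bar>fst u * snd v - snd u * fst v\<bar> * (\<integral>\<^sup>+p. f (a + fst p *\<^sub>R u + snd p *\<^sub>R v) \<partial>lborel)"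
proof (cases "fst u = 0")
  case False
  then show ?thesis using nn_integral_affine_plane_aux[OF assms(1) False J] by simp
next
  case True
  then have v: "fst v \<noteq> 0" using J by auto
  have "(\<integral>\<^sup>+z. f z \<partial>lborel) =
    ennreal \<bar>fst v * snd u - snd v * fst u\<bar> * (\<integral>\<^sup>+p. f (a + fst p *\<^sub>R v + snd p *\<^sub>R u) \<partial>lborel)"
    by (rule nn_integral_affine_plane_aux) (use v J in \<open>auto simp: algebra_simps\<close>)
  also have "(\<integral>\<^sup>+p. f (a + fst p *\<^sub>R v + snd p *\<^sub>R u) \<partial>lborel) =
      (\<integral>\<^sup>+p. f (a + fst p *\<^sub>R u + snd p *\<^sub>R v) \<partial>lborel)"
    by (subst nn_integral_iterated(1), simp, subst nn_integral_iterated(2), simp) (simp add: add_ac)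
  also have "\<bar>fst v * snd u - snd v * fst u\<bar> = \<bar>fst u * snd v - snd u * fst v\<bar>"
    by (simp add: abs_minus_commute mult.commute)
  finally show ?thesis .
qed

section \<open>Lebesgue measure on \<open>real ^ 2\<close>\<close>

lemma measurable_vector_2 [measurable]:
  "(\<lambda>z. vector [fst z, snd z] :: real ^ 2) \<in> borel_measurable (borel :: (real \<times> real) measure)"
proof -
  have "(\<lambda>z. vector [fst z, snd z] :: real ^ 2) = (\<lambda>z. fst z *\<^sub>R axis 1 1 + snd z *\<^sub>R axis 2 1)"
    by (auto simp: vec_eq_iff forall_2 axis_def)
  then show ?thesis by simp
qed

text \<open>Both measures agree on boxes, which determines them. This links the triangles, which
  live in \<open>real ^ 2\<close>, to the iterated integrals over
  \<open>real \<times> real\<close>.\<close>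

lemma lborel_real_2_eq_distr:
  "(lborel :: (real ^ 2) measure) = distr lborel borel (\<lambda>z. vector [fst z, snd z])"
proof (rule lborel_eqI)
  fix l u :: "real ^ 2" assume le: "\<And>b. b \<in> Basis \<Longrightarrow> l \<bullet> b \<le> u \<bullet> b"
  have B: "(Basis :: (real ^ 2) set) = {axis 1 1, axis 2 1}"
    by (auto simp: Basis_vec_def UNIV_2)
  have ne: "axis 1 1 \<noteq> (axis 2 1 :: real ^ 2)"
    by (simp add: axis_eq_axis)
  have lu: "l $ 1 \<le> u $ 1" "l $ 2 \<le> u $ 2"
    using le[of "axis 1 1"] le[of "axis 2 1"] by (simp_all add: B inner_axis)
  have "(\<lambda>z. vector [fst z, snd z]) -` box l u = box (l $ 1, l $ 2) (u $ 1, u $ 2)"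
    by (auto simp: box_def B Basis_prod_def inner_axis)
  then have "emeasure (distr lborel borel (\<lambda>z. vector [fst z, snd z])) (box l u)
     = emeasure lborel (box (l $ 1, l $ 2) (u $ 1, u $ 2))"
    by (simp add: emeasure_distr)
  also have "\<dots> = ennreal ((u $ 1 - l $ 1) * (u $ 2 - l $ 2))"
    using lu by (subst emeasure_lborel_box_eq) (auto simp: Basis_prod_def)
  also have "(u $ 1 - l $ 1) * (u $ 2 - l $ 2) = (\<Prod>b\<in>Basis. (u - l) \<bullet> b)"
    by (simp add: B ne inner_axis)
  finally show "emeasure (distr lborel borel (\<lambda>z. vector [fst z, snd z])) (box l u)
     = ennreal (\<Prod>b\<in>Basis. (u - l) \<bullet> b)" .
qed simp

text \<open>Testing on indicators reduces this to the change of variables for nonnegative functions.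
  As an equality of measures it also serves signed integrands.\<close>

lemma lborel_real_2_affine:
  fixes A U V :: "real ^ 2"
  assumes J: "U $ 1 * V $ 2 - U $ 2 * V $ 1 \<noteq> 0"
  shows "lborel = density (distr lborel borel (\<lambda>p. A + fst p *\<^sub>R U + snd p *\<^sub>R V))
    (\<lambda>_. ennreal \<bar>U $ 1 * V $ 2 - U $ 2 * V $ 1\<bar>)"
    (is "_ = density (distr _ _ ?\<Phi>) (\<lambda>_. ?J)")
proof (rule measure_eqI)
  fix X :: "(real ^ 2) set" assume "X \<in> sets lborel"
  then have [measurable]: "X \<in> sets borel" by simp
  let ?v = "\<lambda>z. vector [fst z, snd z] :: real ^ 2"
  have "emeasure lborel X = (\<integral>\<^sup>+z. indicator X (?v z) \<partial>lborel)"
    by (subst lborel_real_2_eq_distr) (simp add: nn_integral_indicator[symmetric] nn_integral_distr del: nn_integral_indicator)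
  also have "\<dots> = ?J * (\<integral>\<^sup>+p. indicator X (?v ((A $ 1, A $ 2) + fst p *\<^sub>R (U $ 1, U $ 2) + snd p *\<^sub>R (V $ 1, V $ 2))) \<partial>lborel)"
    using J by (subst nn_integral_affine_plane[where u = "(U $ 1, U $ 2)" and v = "(V $ 1, V $ 2)" and a = "(A $ 1, A $ 2)"]) simp_all
  also have "\<dots> = ?J * (\<integral>\<^sup>+p. indicator X (?\<Phi> p) \<partial>lborel)"
  proof -
    have "?v ((A $ 1, A $ 2) + fst p *\<^sub>R (U $ 1, U $ 2) + snd p *\<^sub>R (V $ 1, V $ 2)) = ?\<Phi> p" for p
      by (simp add: vec_eq_iff forall_2)
    then show ?thesis by metis
  qed
  also have "?J * (\<integral>\<^sup>+p. indicator X (?\<Phi> p) \<partial>lborel) = emeasure (density (distr lborel borel ?\<Phi>) (\<lambda>_. ?J)) X"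
    by (simp add: emeasure_density nn_integral_cmult nn_integral_distr del: nn_integral_indicator)
  finally show "emeasure lborel X = emeasure (density (distr lborel borel ?\<Phi>) (\<lambda>_. ?J)) X" .
qed simp

section \<open>The energy in affine coordinates\<close>

lemma affine_image_std_triangle:
  "(\<lambda>p. A + fst p *\<^sub>R U + snd p *\<^sub>R V) ` std_triangle = convex hull {A, A + U, A + V}"
proof -
  have "A + x *\<^sub>R U + y *\<^sub>R V = (1 - x - y) *\<^sub>R A + x *\<^sub>R (A + U) + y *\<^sub>R (A + V)" for x y
    by (simp add: algebra_simps)
  then have "\<exists>u v w. A + fst p *\<^sub>R U + snd p *\<^sub>R V = u *\<^sub>R A + v *\<^sub>R (A + U) + w *\<^sub>R (A + V) \<and>
      0 \<le> u \<and> 0 \<le> v \<and> 0 \<le> w \<and> u + v + w = 1" if "p \<in> std_triangle" for p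
    using that by (intro exI[of _ "1 - fst p - snd p"] exI[of _ "fst p"] exI[of _ "snd p"])
      (auto simp: std_triangle_def)
  moreover have "u *\<^sub>R A + v *\<^sub>R (A + U) + w *\<^sub>R (A + V) \<in> (\<lambda>p. A + fst p *\<^sub>R U + snd p *\<^sub>R V) ` std_triangle"
    if "0 \<le> u" "0 \<le> v" "0 \<le> w" "u + v + w = 1" for u v w
  proof (rule image_eqI[of _ _ "(v, w)"])
    have "u *\<^sub>R A + v *\<^sub>R (A + U) + w *\<^sub>R (A + V) = (u + v + w) *\<^sub>R A + v *\<^sub>R U + w *\<^sub>R V"
      by (simp add: algebra_simps)
    then show "u *\<^sub>R A + v *\<^sub>R (A + U) + w *\<^sub>R (A + V) = A + fst (v, w) *\<^sub>R U + snd (v, w) *\<^sub>R V"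
      using that by simp
  qed (use that in \<open>auto simp: std_triangle_def\<close>)
  ultimately show ?thesis
    unfolding convex_hull_3 by blast
qed

text \<open>Each of the two integrations contributes one Jacobian factor
  \<open>\<bar>J\<bar>\<close>, and the base point \<open>A\<close> cancels in the difference of two
  points.\<close>

lemma interaction_energy_affine_triangle:
  fixes A U V :: "real ^ 2" and k :: "real \<Rightarrow> real"
  assumes [measurable]: "k \<in> borel_measurable borel"
    and J: "U $ 1 * V $ 2 - U $ 2 * V $ 1 \<noteq> 0"
  shows "interaction_energy k ((\<lambda>p. A + fst p *\<^sub>R U + snd p *\<^sub>R V) ` std_triangle) =
    (U $ 1 * V $ 2 - U $ 2 * V $ 1)\<^sup>2 *
    (LINT p:std_triangle|lborel. (LINT p':std_triangle|lborel.
        k (norm (fst (p - p') *\<^sub>R U + snd (p - p') *\<^sub>R V))))"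
proof -
  define \<Phi> where "\<Phi> p = A + fst p *\<^sub>R U + snd p *\<^sub>R V" for p
  define J where "J = U $ 1 * V $ 2 - U $ 2 * V $ 1"
  have [measurable]: "\<Phi> \<in> borel_measurable borel"
    unfolding \<Phi>_def[abs_def] by measurable
  have "inj \<Phi>"
  proof (rule injI)
    fix p p' assume eq: "\<Phi> p = \<Phi> p'"
    define x y where "x = fst p - fst p'" and "y = snd p - snd p'"
    have "x * U $ i + y * V $ i = 0" for i
      using arg_cong[OF eq, of "\<lambda>w. w $ i"] by (simp add: \<Phi>_def x_def y_def algebra_simps)
    \<comment> \<open>Cramer's rule for the two coordinate equations.\<close>
    from this[of 1] this[of 2] have "x * J = 0" "y * J = 0"
      unfolding J_def by algebra+
    then show "p = p'"
      using assms(2) by (auto simp: J_def x_def y_def prod_eq_iff)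
  qed
  then have ind: "indicator (\<Phi> ` std_triangle) (\<Phi> p) = (indicator std_triangle p :: real)" for p
    by (simp add: indicator_def inj_image_mem_iff)
  have "compact (\<Phi> ` std_triangle)"
    unfolding \<Phi>_def[abs_def] affine_image_std_triangle by (intro finite_imp_compact_convex_hull) simp
  then have [measurable]: "\<Phi> ` std_triangle \<in> sets borel"
    by (simp add: borel_compact)
  have transfer: "(LINT x:\<Phi> ` std_triangle|lborel. f x) = \<bar>J\<bar> * (LINT p:std_triangle|lborel. f (\<Phi> p))"
    if [measurable]: "f \<in> borel_measurable borel" for f :: "real ^ 2 \<Rightarrow> real"
    unfolding set_lebesgue_integral_def
    by (subst lborel_real_2_affine[OF assms(2), of A])
       (simp add: integral_density integral_distr ind J_def flip: \<Phi>_def)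
  have "interaction_energy k (\<Phi> ` std_triangle) =
     \<bar>J\<bar> * (LINT p:std_triangle|lborel. (LINT y:\<Phi> ` std_triangle|lborel. k (norm (\<Phi> p - y))))"
    unfolding interaction_energy_def by (rule transfer) (simp add: set_lebesgue_integral_def)
  also have "\<dots> = \<bar>J\<bar> * (LINT p:std_triangle|lborel. \<bar>J\<bar> * (LINT p':std_triangle|lborel. k (norm (\<Phi> p - \<Phi> p'))))"
    by (subst transfer) simp_all
  also have "\<dots> = J\<^sup>2 * (LINT p:std_triangle|lborel. (LINT p':std_triangle|lborel. k (norm (\<Phi> p - \<Phi> p'))))"
    by (simp add: power2_eq_square mult.assoc[symmetric])
  finally show ?thesis
    by (simp add: \<Phi>_def[abs_def] J_def algebra_simps)
qed

text \<open>Absolute integrability gives Fubini and the splitting into positive and negative parts;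
  \<open>ennreal\<close> truncates at 0, so the two terms are exactly these parts. This carries
  identities between nonnegative integrals over to kernels that change sign.\<close>

lemma (in pair_sigma_finite) integral_iterated_eq_enn2real:
  fixes f :: "'a \<Rightarrow> 'b \<Rightarrow> real"
  assumes f [measurable]: "case_prod f \<in> borel_measurable (M1 \<Otimes>\<^sub>M M2)"
    and fin: "(\<integral>\<^sup>+x. (\<integral>\<^sup>+y. ennreal \<bar>f x y\<bar> \<partial>M2) \<partial>M1) < \<infinity>"
  shows "(\<integral>x. (\<integral>y. f x y \<partial>M2) \<partial>M1) =
    enn2real (\<integral>\<^sup>+x. (\<integral>\<^sup>+y. ennreal (f x y) \<partial>M2) \<partial>M1) - enn2real (\<integral>\<^sup>+x. (\<integral>\<^sup>+y. ennreal (- f x y) \<partial>M2) \<partial>M1)"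
proof -
  have i: "integrable (M1 \<Otimes>\<^sub>M M2) (case_prod f)"
    unfolding integrable_iff_bounded using fin
    by (auto simp: M2.nn_integral_fst[symmetric] split_beta')
  have "(\<integral>x. (\<integral>y. f x y \<partial>M2) \<partial>M1) = integral\<^sup>L (M1 \<Otimes>\<^sub>M M2) (case_prod f)"
    using integral_fst'[OF i] by simp
  also note real_lebesgue_integral_def[OF i]
  finally show ?thesis
    by (simp add: M2.nn_integral_fst[symmetric])
qed

text \<open>Bounding \<open>(1 - r)^2\<close> by 1 and putting \<open>\<rho> = r l\<close> leaves
  the integral of \<open>\<bar>\<rho> * k \<rho>\<bar>\<close> up to \<open>l\<close>, divided by
  \<open>l^2\<close>; both factors are estimated uniformly for \<open>l\<close> between
  \<open>a\<close> and \<open>b\<close>.\<close>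

lemma nn_integral_edge_kernel_bound:
  fixes k :: "real \<Rightarrow> real"
  assumes int: "\<And>y. y > 0 \<Longrightarrow> set_integrable lborel {0..y} (\<lambda>\<rho>. \<rho> * k \<rho>)"
    and [measurable]: "k \<in> borel_measurable borel" and "0 < a" "a \<le> l" "l \<le> b"
  shows "(\<integral>\<^sup>+r\<in>{0..1}. ennreal (r * (1 - r)\<^sup>2) * ennreal \<bar>k (r * l)\<bar> \<partial>lborel)
     \<le> ennreal ((LINT \<rho>:{0..b}|lborel. \<bar>\<rho> * k \<rho>\<bar>) / a\<^sup>2)"
proof -
  have l: "l > 0" using assms by linarith
  have i: "set_integrable lborel {0..y} (\<lambda>\<rho>. \<bar>\<rho> * k \<rho>\<bar>)" if "y > 0" for y
    using set_integrable_abs[OF int[OF that]] by simp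
  have il: "set_integrable lborel {0..1} (\<lambda>r. \<bar>(r * l) * k (r * l)\<bar> / l)"
    using set_integral_unit_rescale(1)[OF l i[OF l]] l by simp
  have "(\<integral>\<^sup>+r\<in>{0..1}. ennreal (r * (1 - r)\<^sup>2) * ennreal \<bar>k (r * l)\<bar> \<partial>lborel)
    \<le> (\<integral>\<^sup>+r. ennreal (indicator {0..1} r *\<^sub>R (\<bar>(r * l) * k (r * l)\<bar> / l)) \<partial>lborel)"
  proof (rule nn_integral_mono)
    fix r :: real
    have "r * (1 - r)\<^sup>2 * \<bar>k (r * l)\<bar> \<le> r * \<bar>k (r * l)\<bar>" if "0 \<le> r" "r \<le> 1"
      using that by (intro mult_right_mono) (auto intro!: mult_left_le power_le_one)
    then show "ennreal (r * (1 - r)\<^sup>2) * ennreal \<bar>k (r * l)\<bar> * indicator {0..1} r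
      \<le> ennreal (indicator {0..1} r *\<^sub>R (\<bar>(r * l) * k (r * l)\<bar> / l))"
      using l by (auto simp: indicator_def abs_mult ennreal_mult'[symmetric] intro!: ennreal_leI)
  qed
  also have "\<dots> = ennreal (LINT r:{0..1}|lborel. \<bar>(r * l) * k (r * l)\<bar> / l)"
    unfolding set_lebesgue_integral_def using il l
    by (intro nn_integral_eq_integral) (auto simp: set_integrable_def)
  also have "(LINT r:{0..1}|lborel. \<bar>(r * l) * k (r * l)\<bar> / l) = (LINT \<rho>:{0..l}|lborel. \<bar>\<rho> * k \<rho>\<bar>) / l / l"
    using set_integral_unit_rescale(2)[OF l i[OF l]] by simp
  also have "\<dots> \<le> (LINT \<rho>:{0..b}|lborel. \<bar>\<rho> * k \<rho>\<bar>) / a / a"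
  proof -
    have "(LINT \<rho>:{0..l}|lborel. \<bar>\<rho> * k \<rho>\<bar>) \<le> (LINT \<rho>:{0..b}|lborel. \<bar>\<rho> * k \<rho>\<bar>)"
      unfolding set_lebesgue_integral_def using i[of l] i[of b] l assms
      by (intro integral_mono) (auto simp: set_integrable_def indicator_def)
    moreover have "0 \<le> (LINT \<rho>:{0..b}|lborel. \<bar>\<rho> * k \<rho>\<bar>)"
      unfolding set_lebesgue_integral_def by (intro Bochner_Integration.integral_nonneg) simp
    ultimately show ?thesis
      using assms l by (intro frac_le divide_nonneg_pos) auto
  qed
  finally show ?thesis
    by (simp add: power2_eq_square ennreal_leI)
qed

text \<open>The covariogram formula is applied to the positive and negative parts of
  \<open>k\<close> composed with the norm \<open>N\<close>. Homogeneity of \<open>N\<close>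
  separates the radius \<open>r\<close> from the position \<open>s\<close> on an edge, and
  finiteness on every edge permits the subtraction.\<close>

lemma std_triangle_energy:
  fixes k :: "real \<Rightarrow> real" and U V :: "'a::euclidean_space"
  assumes int: "\<And>y. y > 0 \<Longrightarrow> set_integrable lborel {0..y} (\<lambda>\<rho>. \<rho> * k \<rho>)"
    and [measurable]: "k \<in> borel_measurable borel"
    and indep: "\<And>x y. x *\<^sub>R U + y *\<^sub>R V = 0 \<Longrightarrow> x = 0 \<and> y = 0"
  defines "E \<equiv> \<lambda>l. LINT r:{0..1}|lborel. r * (1 - r)\<^sup>2 * k (r * l)"
  shows "(LINT p:std_triangle|lborel. (LINT p':std_triangle|lborel.
        k (norm (fst (p - p') *\<^sub>R U + snd (p - p') *\<^sub>R V)))) =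
    (LINT s:{0..1}|lborel. E (norm (U - s *\<^sub>R V))) +
    (LINT s:{0..1}|lborel. E (norm (s *\<^sub>R U + (1 - s) *\<^sub>R V))) +
    (LINT s:{0..1}|lborel. E (norm ((s - 1) *\<^sub>R U + V)))"
proof -
  define N where "N z = norm (fst z *\<^sub>R U + snd z *\<^sub>R V)" for z
  have [measurable]: "N \<in> borel_measurable borel"
    unfolding N_def[abs_def] by measurable
  have N_minus: "N (- z) = N z" for z
    using norm_minus_cancel[of "fst z *\<^sub>R U + snd z *\<^sub>R V"] by (simp add: N_def)
  have N_scale: "N (r *\<^sub>R z) = r * N z" if "r \<ge> 0" for r z
    using norm_scaleR[of r "fst z *\<^sub>R U + snd z *\<^sub>R V"] that by (simp add: N_def algebra_simps)
  \<comment> \<open>These run along three edges of the unit hexagon, one from each opposite pair;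
    scaling by \<open>r\<close> gives the arguments in
    \<open>nn_integral_std_triangle_pairs\<close>.\<close>
  define e1 e2 e3 :: "real \<Rightarrow> real \<times> real"
    where "e1 s = (1, - s)" and "e2 s = (s, 1 - s)" and "e3 s = (s - 1, 1)" for s
  define S :: "real \<times> real \<Rightarrow> real" where "S = indicator std_triangle"
  define F where "F \<kappa> p p' = S p * S p' * \<kappa> (N (p - p'))" for \<kappa> :: "real \<Rightarrow> real" and p p'
  define G where "G \<kappa> e s r = indicator {0..1} s * indicator {0..1} r * (r * (1 - r)\<^sup>2 * \<kappa> (r * N (e s)))"
    for \<kappa> :: "real \<Rightarrow> real" and e :: "real \<Rightarrow> real \<times> real" and s r :: real
  let ?nF = "\<lambda>\<kappa>. \<integral>\<^sup>+p. (\<integral>\<^sup>+p'. ennreal (F \<kappa> p p') \<partial>lborel) \<partial>lborel"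
  let ?nG = "\<lambda>\<kappa> e. \<integral>\<^sup>+s. (\<integral>\<^sup>+r. ennreal (G \<kappa> e s r) \<partial>lborel) \<partial>lborel"
  have [measurable]: "S \<in> borel_measurable borel"
    unfolding S_def by measurable
  have F_meas: "case_prod (F \<kappa>) \<in> borel_measurable (lborel \<Otimes>\<^sub>M lborel)"
    if [measurable]: "\<kappa> \<in> borel_measurable borel" for \<kappa>
    unfolding F_def[abs_def] by measurable
  have e_meas [measurable]: "e1 \<in> borel_measurable borel" "e2 \<in> borel_measurable borel" "e3 \<in> borel_measurable borel"
    unfolding e1_def[abs_def] e2_def[abs_def] e3_def[abs_def] by measurable
  have G_meas: "case_prod (G \<kappa> e) \<in> borel_measurable (lborel \<Otimes>\<^sub>M lborel)"
    if [measurable]: "\<kappa> \<in> borel_measurable borel" "e \<in> borel_measurable borel" for \<kappa> e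
    unfolding G_def[abs_def] by measurable
  have nG: "(\<integral>\<^sup>+s\<in>{0..1}. (\<integral>\<^sup>+r\<in>{0..1}. ennreal (r * (1 - r)\<^sup>2) * ennreal (\<kappa> (N (f r s))) \<partial>lborel) \<partial>lborel) = ?nG \<kappa> e"
    if f: "\<And>r s. f r s = r *\<^sub>R e s" and [measurable]: "\<kappa> \<in> borel_measurable borel" "e \<in> borel_measurable borel" for f e \<kappa>
  proof (rule nn_integral_cong)
    fix s :: real
    have "(\<integral>\<^sup>+r\<in>{0..1}. ennreal (r * (1 - r)\<^sup>2) * ennreal (\<kappa> (N (f r s))) \<partial>lborel)
      = (\<integral>\<^sup>+r\<in>{0..1}. ennreal (r * (1 - r)\<^sup>2 * \<kappa> (r * N (e s))) \<partial>lborel)"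
      by (intro nn_integral_cong) (auto simp: f N_scale indicator_def ennreal_mult')
    also have "\<dots> * indicator {0..1} s = (\<integral>\<^sup>+r. ennreal (G \<kappa> e s r) \<partial>lborel)"
      by (subst nn_integral_multc[symmetric], simp, intro nn_integral_cong) (auto simp: G_def indicator_def)
    finally show "(\<integral>\<^sup>+r\<in>{0..1}. ennreal (r * (1 - r)\<^sup>2) * ennreal (\<kappa> (N (f r s))) \<partial>lborel) * indicator {0..1} s
      = (\<integral>\<^sup>+r. ennreal (G \<kappa> e s r) \<partial>lborel)" .
  qed
  have nn: "?nF \<kappa> = ?nG \<kappa> e1 + ?nG \<kappa> e2 + ?nG \<kappa> e3" if [measurable]: "\<kappa> \<in> borel_measurable borel" for \<kappa>
  proof -
    have "?nF \<kappa> = (\<integral>\<^sup>+p\<in>std_triangle. (\<integral>\<^sup>+p'\<in>std_triangle. ennreal (\<kappa> (N (p - p'))) \<partial>lborel) \<partial>lborel)"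
      by (intro nn_integral_cong, subst nn_integral_multc[symmetric], simp, intro nn_integral_cong)
         (auto simp: F_def S_def indicator_def)
    also have "\<dots> = ?nG \<kappa> e1 + ?nG \<kappa> e2 + ?nG \<kappa> e3"
      by (subst nn_integral_std_triangle_pairs, simp, simp add: N_minus, intro arg_cong2[where f = "(+)"] nG that e_meas)
         (auto simp: e1_def e2_def e3_def algebra_simps)
    finally show ?thesis .
  qed
  \<comment> \<open>Absolute convergence is checked on the edges and later carried back to pairs of
    points by \<open>nn\<close>, applied to the absolute value of \<open>k\<close>.\<close>
  have G_fin: "?nG (\<lambda>x. \<bar>k x\<bar>) e < \<infinity>"
    if e: "e = e1 \<or> e = e2 \<or> e = e3" for e
  proof -
    have "e s \<noteq> 0" for s
      using e by (auto simp: e1_def e2_def e3_def prod_eq_iff)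
    then have pos: "N (e s) > 0" for s
      using indep[of "fst (e s)" "snd (e s)"] by (auto simp: N_def prod_eq_iff)
    have cont: "continuous_on {0..1} (\<lambda>s. N (e s))"
      using e unfolding N_def[abs_def] e1_def e2_def e3_def by (auto intro!: continuous_intros)
    \<comment> \<open>By compactness \<open>N\<close> lies between two positive constants on the
      edge, which gives one bound for all \<open>s\<close>.\<close>
    obtain s0 where s0: "s0 \<in> {0..1}" "\<And>s. s \<in> {0..1} \<Longrightarrow> N (e s0) \<le> N (e s)"
      using continuous_attains_inf[OF _ _ cont] by auto
    obtain s1 where s1: "s1 \<in> {0..1}" "\<And>s. s \<in> {0..1} \<Longrightarrow> N (e s) \<le> N (e s1)"
      using continuous_attains_sup[OF _ _ cont] by auto
    have [measurable]: "e \<in> borel_measurable borel"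
      using e e_meas by auto
    let ?C = "ennreal ((LINT \<rho>:{0..N (e s1)}|lborel. \<bar>\<rho> * k \<rho>\<bar>) / (N (e s0))\<^sup>2)"
    have "?nG (\<lambda>x. \<bar>k x\<bar>) e \<le> (\<integral>\<^sup>+s. ?C * indicator {0..1::real} s \<partial>lborel)"
    proof (subst nG[OF refl, symmetric], simp, simp, rule nn_integral_mono)
      fix s :: real
      have "(\<integral>\<^sup>+r\<in>{0..1}. ennreal (r * (1 - r)\<^sup>2) * ennreal \<bar>k (N (r *\<^sub>R e s))\<bar> \<partial>lborel)
        = (\<integral>\<^sup>+r\<in>{0..1}. ennreal (r * (1 - r)\<^sup>2) * ennreal \<bar>k (r * N (e s))\<bar> \<partial>lborel)"
        by (intro nn_integral_cong) (auto simp: N_scale indicator_def)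
      also have "\<dots> \<le> ?C" if "s \<in> {0..1}"
        using s0 s1 that by (intro nn_integral_edge_kernel_bound int pos) auto
      finally show "(\<integral>\<^sup>+r\<in>{0..1}. ennreal (r * (1 - r)\<^sup>2) * ennreal \<bar>k (N (r *\<^sub>R e s))\<bar> \<partial>lborel) * indicator {0..1} s
         \<le> ?C * indicator {0..1} s"
        by (auto simp: indicator_def)
    qed
    also have "\<dots> = ?C"
      by (simp add: nn_integral_cmult_indicator)
    finally show ?thesis
      by (simp add: order_le_less_trans)
  qed
  have abs: "\<bar>F k p p'\<bar> = F (\<lambda>x. \<bar>k x\<bar>) p p'" "- F k p p' = F (\<lambda>x. - k x) p p'"
     "\<bar>G k e s r\<bar> = G (\<lambda>x. \<bar>k x\<bar>) e s r" "- G k e s r = G (\<lambda>x. - k x) e s r" for p p' e s r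
    by (auto simp: F_def G_def S_def abs_mult indicator_def)
  have fin: "?nG k e < \<infinity>" "?nG (\<lambda>x. - k x) e < \<infinity>" if "e = e1 \<or> e = e2 \<or> e = e3" for e
  proof -
    show "?nG k e < \<infinity>"
      by (rule order_le_less_trans[OF _ G_fin[OF that]], intro nn_integral_mono, unfold abs(3)[symmetric])
         (simp add: ennreal_leI)
    show "?nG (\<lambda>x. - k x) e < \<infinity>"
      by (rule order_le_less_trans[OF _ G_fin[OF that]], intro nn_integral_mono, unfold abs(3)[symmetric] abs(4)[symmetric])
         (simp add: ennreal_leI)
  qed
  have G_int: "(LINT s:{0..1}|lborel. E (N (e s))) = enn2real (?nG k e) - enn2real (?nG (\<lambda>x. - k x) e)"
    if e: "e = e1 \<or> e = e2 \<or> e = e3" for e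
  proof -
    have "(LINT s:{0..1}|lborel. E (N (e s))) = (\<integral>s. (\<integral>r. G k e s r \<partial>lborel) \<partial>lborel)"
      unfolding set_lebesgue_integral_def E_def G_def
      by (intro Bochner_Integration.integral_cong refl) (simp add: mult.assoc)
    also have "\<dots> = enn2real (?nG k e) - enn2real (?nG (\<lambda>x. - k x) e)"
      using G_fin[OF e] e e_meas
      by (subst lborel_pair.integral_iterated_eq_enn2real) (auto simp: abs intro!: G_meas)
    finally show ?thesis .
  qed
  have "(LINT p:std_triangle|lborel. (LINT p':std_triangle|lborel. k (N (p - p')))) =
      (\<integral>p. (\<integral>p'. F k p p' \<partial>lborel) \<partial>lborel)"
    unfolding set_lebesgue_integral_def F_def S_def
    by (intro Bochner_Integration.integral_cong refl) (simp add: mult.assoc)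
  also have "\<dots> = enn2real (?nF k) - enn2real (?nF (\<lambda>x. - k x))"
  proof (subst lborel_pair.integral_iterated_eq_enn2real)
    show "(\<integral>\<^sup>+p. (\<integral>\<^sup>+p'. ennreal \<bar>F k p p'\<bar> \<partial>lborel) \<partial>lborel) < \<infinity>"
      unfolding abs using G_fin by (subst nn) simp_all
  qed (simp_all add: F_meas abs)
  also have "\<dots> = (LINT s:{0..1}|lborel. E (N (e1 s))) + (LINT s:{0..1}|lborel. E (N (e2 s))) + (LINT s:{0..1}|lborel. E (N (e3 s)))"
    using fin by (simp add: nn G_int enn2real_plus)
  finally show ?thesis
    by (simp add: N_def e1_def e2_def e3_def)
qed

section \<open>Area, angle and side ratio\<close>

lemma abs_cos_less_one:
  fixes \<alpha> :: real
  assumes "0 < \<alpha>" "\<alpha> < pi"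
  shows "\<bar>cos \<alpha>\<bar> < 1"
  using sin_gt_zero[OF assms] by (simp add: abs_square_less_1[symmetric] cos_squared_eq)

text \<open>Area and angle fix the product \<open>norm U * norm V = 2 * m / sin \<alpha>\<close>,
  called \<open>P\<close>, so that \<open>(norm U)^2 = P q\<close> and
  \<open>(norm V)^2 = P / q\<close>. Hence \<open>q\<close> enters only through the quadratic forms
  inside \<open>\<eta>\<close>.\<close>

lemma triangle_interaction_energy:
  fixes k :: "real \<Rightarrow> real" and m \<alpha> q :: real
  assumes tri: "triangle_angle_ratio m \<alpha> q \<Omega>" and m: "m > 0" and \<alpha>: "0 < \<alpha>" "\<alpha> < pi"
    and int: "\<And>y. y > 0 \<Longrightarrow> set_integrable lborel {0..y} (\<lambda>\<rho>. \<rho> * k \<rho>)"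
    and k: "k \<in> borel_measurable borel"
  defines "\<eta> \<equiv> \<lambda>x. LINT r:{0..1}|lborel. r * (1 - r)\<^sup>2 * k (r * sqrt (2 * m / sin \<alpha> * x))"
  assumes cont: "continuous_on {0<..} \<eta>"
  shows "interaction_energy k \<Omega> = 4 * m\<^sup>2 * integral {0..1} (\<lambda>s.
     \<eta> (q + s\<^sup>2 / q - 2 * s * cos \<alpha>) + \<eta> (q * s\<^sup>2 + 1 / q - 2 * s * cos \<alpha>)
     + \<eta> (q * s\<^sup>2 + (1 - s)\<^sup>2 / q + 2 * s * (1 - s) * cos \<alpha>))"
proof -
  obtain A B C where nc: "\<not> collinear {A, B, C}" and \<Omega>: "\<Omega> = convex hull {A, B, C}"
    and area: "measure lborel \<Omega> = m" and ang: "vertex_angle A B C = \<alpha>"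
    and q_eq: "q = dist A B / dist A C"
    using tri unfolding triangle_angle_ratio_def by blast
  define U V where "U = B - A" and "V = C - A"
  have UV: "norm U > 0" "norm V > 0" "dist A B = norm U" "dist A C = norm V"
    using nc by (auto simp: U_def V_def dist_norm norm_minus_commute insert_commute)
  define J where "J = U $ 1 * V $ 2 - U $ 2 * V $ 1"
  have J: "\<bar>J\<bar> = 2 * m"
    using content_triangle[of A B C] area by (simp add: J_def U_def V_def \<Omega> abs_minus_commute mult.commute)
  have q: "q > 0" "norm U = q * norm V"
    using UV(1,2) unfolding q_eq UV(3,4) by simp_all
  have "\<bar>U \<bullet> V / (norm U * norm V)\<bar> \<le> 1"
    using Cauchy_Schwarz_ineq2[of U V] UV by (simp add: abs_mult)
  then have "cos \<alpha> = U \<bullet> V / (norm U * norm V)"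
    using ang UV by (auto simp: vertex_angle_def cos_arccos_abs U_def[symmetric] V_def[symmetric])
  then have inner: "U \<bullet> V = norm U * norm V * cos \<alpha>"
    using UV by simp
  have sin: "sin \<alpha> > 0"
    using \<alpha> by (simp add: sin_gt_zero)
  have c: "\<bar>cos \<alpha>\<bar> < 1"
    by (rule abs_cos_less_one) fact+
  define P where "P = 2 * m / sin \<alpha>"
  \<comment> \<open>Lagrange's identity: the squared lengths and the inner product determine the
    square of the determinant \<open>J\<close>.\<close>
  have "(norm U * norm V * sin \<alpha>)\<^sup>2 = (norm U)\<^sup>2 * (norm V)\<^sup>2 - (U \<bullet> V)\<^sup>2"
    unfolding inner power_mult_distrib sin_squared_eq by (simp add: algebra_simps)
  also have "\<dots> = J\<^sup>2"
    unfolding power2_norm_eq_inner J_def by (simp add: inner_vec_def sum_2 power2_eq_square algebra_simps)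
  finally have "\<bar>norm U * norm V * sin \<alpha>\<bar> = \<bar>J\<bar>"
    by (metis power2_eq_iff abs_minus)
  then have P: "P = norm U * norm V"
    using sin UV J by (simp add: P_def field_simps)
  have norm: "norm (x *\<^sub>R U + y *\<^sub>R V) = sqrt (P * (q * x\<^sup>2 + y\<^sup>2 / q + 2 * x * y * cos \<alpha>))" for x y
  proof -
    have "(norm (x *\<^sub>R U + y *\<^sub>R V))\<^sup>2 = x\<^sup>2 * (norm U)\<^sup>2 + y\<^sup>2 * (norm V)\<^sup>2 + 2 * x * y * (U \<bullet> V)"
      unfolding power2_norm_eq_inner
      by (simp add: inner_simps inner_commute power2_eq_square algebra_simps)
    also have "\<dots> = P * (q * x\<^sup>2 + y\<^sup>2 / q + 2 * x * y * cos \<alpha>)"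
      unfolding P inner q(2) using q(1) by (simp add: field_simps power2_eq_square)
    finally show ?thesis
      by (metis norm_ge_zero real_sqrt_unique)
  qed
  define E where "E l = (LINT r:{0..1}|lborel. r * (1 - r)\<^sup>2 * k (r * l))" for l
  define Q1 Q2 Q3 where Q: "Q1 s = q + s\<^sup>2 / q - 2 * s * cos \<alpha>" "Q2 s = q * s\<^sup>2 + 1 / q - 2 * s * cos \<alpha>"
    "Q3 s = q * s\<^sup>2 + (1 - s)\<^sup>2 / q + 2 * s * (1 - s) * cos \<alpha>" for s
  note Qpos = edge_length_sq_pos[OF q(1) c, folded Q]
  have E_sqrt: "E (sqrt (P * x)) = \<eta> x" for x
    by (simp add: E_def \<eta>_def P_def)
  have norms: "norm (U - s *\<^sub>R V) = sqrt (P * Q1 s)" "norm (s *\<^sub>R U + (1 - s) *\<^sub>R V) = sqrt (P * Q3 s)"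
    "norm ((s - 1) *\<^sub>R U + V) = sqrt (P * Q2 (1 - s))" for s
  proof -
    show "norm (U - s *\<^sub>R V) = sqrt (P * Q1 s)"
      using norm[of 1 "- s"] by (simp add: Q)
    show "norm (s *\<^sub>R U + (1 - s) *\<^sub>R V) = sqrt (P * Q3 s)"
      by (simp only: norm Q)
    \<comment> \<open>This edge is traversed in the direction opposite to that of \<open>Q2\<close>;
      the reflection of the unit interval undoes this under the integral.\<close>
    have "q * (s - 1)\<^sup>2 + 1\<^sup>2 / q + 2 * (s - 1) * 1 * cos \<alpha> = Q2 (1 - s)"
      by (simp add: Q power2_eq_square algebra_simps)
    then show "norm ((s - 1) *\<^sub>R U + V) = sqrt (P * Q2 (1 - s))"
      using norm[of "s - 1" 1] by simp
  qed
  have cQ: "continuous_on {0..1} (\<lambda>s. \<eta> (Q1 s))" "continuous_on {0..1} (\<lambda>s. \<eta> (Q2 s))" "continuous_on {0..1} (\<lambda>s. \<eta> (Q3 s))"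
    "continuous_on {0..1} (\<lambda>s. \<eta> (Q2 (1 - s)))"
  proof -
    have \<eta>: "continuous_on {0..1} (\<lambda>s. \<eta> (Q s))"
      if "continuous_on {0..1} Q" "\<And>s. Q s > 0" for Q :: "real \<Rightarrow> real"
      using continuous_on_compose2[OF cont that(1)] that(2) by (simp add: image_subset_iff)
    show "continuous_on {0..1} (\<lambda>s. \<eta> (Q1 s))" "continuous_on {0..1} (\<lambda>s. \<eta> (Q2 s))" "continuous_on {0..1} (\<lambda>s. \<eta> (Q3 s))"
      "continuous_on {0..1} (\<lambda>s. \<eta> (Q2 (1 - s)))"
      by (rule \<eta>, use q in \<open>force simp: Q intro!: continuous_intros\<close>, rule Qpos)+
  qed
  have lint: "(LINT s:{0..1}|lborel. f s) = integral {0..1} f" if "continuous_on {0..1} f" for f :: "real \<Rightarrow> real"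
    by (rule set_borel_integral_eq_integral(2)) (use that in \<open>auto intro: borel_integrable_atLeastAtMost'\<close>)
  have "interaction_energy k \<Omega> = J\<^sup>2 * (LINT p:std_triangle|lborel. (LINT p':std_triangle|lborel.
        k (norm (fst (p - p') *\<^sub>R U + snd (p - p') *\<^sub>R V))))"
  proof -
    have "{A, B, C} = {A, A + U, A + V}" by (simp add: U_def V_def)
    then show ?thesis
      unfolding \<Omega> J_def using J m
      by (simp only: affine_image_std_triangle[symmetric]) (rule interaction_energy_affine_triangle[OF k], auto simp: J_def)
  qed
  also have "\<dots> = J\<^sup>2 * ((LINT s:{0..1}|lborel. E (norm (U - s *\<^sub>R V))) +
    (LINT s:{0..1}|lborel. E (norm (s *\<^sub>R U + (1 - s) *\<^sub>R V))) +
    (LINT s:{0..1}|lborel. E (norm ((s - 1) *\<^sub>R U + V))))"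
  proof (subst std_triangle_energy[OF int k])
    fix x y assume 0: "x *\<^sub>R U + y *\<^sub>R V = 0"
    have "x * U $ i + y * V $ i = 0" for i
      using arg_cong[OF 0, of "\<lambda>w. w $ i"] by simp
    from this[of 1] this[of 2] have "x * J = 0" "y * J = 0"
      unfolding J_def by algebra+
    then show "x = 0 \<and> y = 0" using J m by auto
  qed (simp_all add: E_def)
  also have "\<dots> = J\<^sup>2 * (integral {0..1} (\<lambda>s. \<eta> (Q1 s)) + integral {0..1} (\<lambda>s. \<eta> (Q3 s)) + integral {0..1} (\<lambda>s. \<eta> (Q2 s)))"
    unfolding norms E_sqrt using integral_unit_reflect[of "\<lambda>s. \<eta> (Q2 s)"] by (simp add: lint cQ)
  also have "\<dots> = J\<^sup>2 * integral {0..1} (\<lambda>s. \<eta> (Q1 s) + \<eta> (Q2 s) + \<eta> (Q3 s))"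
    by (simp add: integral_add integrable_continuous_real cQ integrable_add)
  also have "J\<^sup>2 = 4 * m\<^sup>2"
    using arg_cong[OF J, of "\<lambda>x. x\<^sup>2"] by (simp add: power_mult_distrib)
  finally show ?thesis
    by (simp add: Q)
qed

section \<open>Conclusion for a general kernel\<close>

lemma set_integrable_weighted_kernel:
  fixes K :: "real \<Rightarrow> real"
  assumes cont: "continuous_on {0<..} K" and int: "set_integrable lborel {0<..<1} (\<lambda>r. K r * r)"
  shows "set_integrable lborel {0..y} (\<lambda>\<rho>. \<rho> * K \<rho>)"
proof -
  \<comment> \<open>The closed interval is assembled from the point 0, where the factor
    \<open>r\<close> annihilates whatever \<open>K 0\<close> is, the open unit interval of the
    hypothesis, and a compact interval on which \<open>K\<close> is continuous.\<close>
  have "set_integrable lborel {0} (\<lambda>r. K r * r)"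
  proof -
    have "(\<lambda>r. indicator {0} r *\<^sub>R (K r * r)) = (\<lambda>_. 0)"
      by (auto simp: indicator_def)
    then show ?thesis
      by (simp add: set_integrable_def)
  qed
  moreover have "set_integrable lborel {1..max 1 y} (\<lambda>r. K r * r)"
    by (intro borel_integrable_atLeastAtMost' continuous_intros continuous_on_subset[OF cont]) auto
  ultimately have "set_integrable lborel ({0} \<union> {0<..<1} \<union> {1..max 1 y}) (\<lambda>r. K r * r)"
    by (intro set_integrable_Un int) auto
  then have "set_integrable lborel {0..y} (\<lambda>r. K r * r)"
    by (rule set_integrable_subset) auto
  then show ?thesis
    by (simp add: mult.commute)
qed

theorem theorem1p5:
  fixes K :: "real \<Rightarrow> real" and m \<alpha> :: real and \<Omega> :: "real \<Rightarrow> (real ^ 2) set"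
  assumes "K C1_differentiable_on {0<..}"
    and "strict_antimono_on {0<..} K"
    and "set_integrable lborel {0<..<1} (\<lambda>r. K r * r)"
    and "m > 0"
    and "0 < \<alpha>" and "\<alpha> < pi"
    and "\<And>q. q \<ge> 1 \<Longrightarrow> triangle_angle_ratio m \<alpha> q (\<Omega> q)"
  shows "strict_antimono_on {1..} (\<lambda>q. interaction_energy K (\<Omega> q))"
proof -
  have K_cont: "continuous_on {0<..} K"
    by (rule C1_differentiable_imp_continuous_on[OF assms(1)])
  \<comment> \<open>\<open>K\<close> is arbitrary on the negative reals; \<open>k\<close> agrees with it on all norms and is Borel.\<close>
  define k where "k r = (if 0 < r then K r else K 0)" for r
  have k_eq: "k r = K r" if "0 < r" for r
    using that by (simp add: k_def)
  have [measurable]: "k \<in> borel_measurable borel"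
  proof -
    have "k = (\<lambda>r. indicator {0<..} r *\<^sub>R K r + indicator {..0} r * K 0)"
      by (auto simp: k_def indicator_def)
    moreover have "(\<lambda>r. indicator {0<..} r *\<^sub>R K r) \<in> borel_measurable borel"
      by (rule borel_measurable_continuous_on_indicator[OF _ K_cont]) simp
    ultimately show ?thesis
      by simp
  qed
  have energy_k: "interaction_energy K \<Omega>' = interaction_energy k \<Omega>'" for \<Omega>'
  proof -
    have "K (norm z) = k (norm z)" for z :: "real ^ 2"
      by (cases "z = 0") (simp_all add: k_def)
    then show ?thesis
      by (simp only: interaction_energy_def)
  qed
  have k_cont: "continuous_on {0<..} k"
    using K_cont by (rule continuous_on_eq) (simp add: k_eq)
  have k_anti: "strict_antimono_on {0<..} k"
    using assms(2) by (simp add: monotone_on_def k_eq)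
  have k_int: "set_integrable lborel {0..y} (\<lambda>\<rho>. \<rho> * k \<rho>)" for y
  proof -
    have "set_integrable lborel {0<..<1} (\<lambda>r. k r * r)"
      using assms(3) by (rule set_integrable_cong[THEN iffD1, rotated 3]) (auto simp: k_eq)
    then show ?thesis
      by (rule set_integrable_weighted_kernel[OF k_cont])
  qed
  \<comment> \<open>This constant depends on \<open>m\<close> and \<open>\<alpha>\<close> alone, so
    one pair \<open>\<eta>\<close>, \<open>g\<close> serves all \<open>q\<close> and the energies
    form a single function of \<open>q\<close>.\<close>
  define P where "P = 2 * m / sin \<alpha>"
  have sin: "sin \<alpha> > 0"
    using assms(5,6) by (simp add: sin_gt_zero)
  have P: "P > 0"
    using assms(4) sin by (simp add: P_def)
  have c: "\<bar>cos \<alpha>\<bar> < 1"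
    using assms(5,6) by (rule abs_cos_less_one)
  define \<eta> where "\<eta> x = (LINT r:{0..1}|lborel. r * (1 - r)\<^sup>2 * k (r * sqrt (P * x)))" for x
  define g where "g x = (LINT r:{0..1}|lborel. r\<^sup>2 * (1 - r) * k (r * sqrt (P * x)))" for x
  have ek: "(\<eta> has_real_derivative (g x - \<eta> x) / x) (at x)" if "x > 0" for x
    unfolding \<eta>_def[abs_def] g_def by (rule edge_kernel(1)[OF k_int k_cont k_anti P that])
  have g: "continuous_on {0<..} g" "strict_antimono_on {0<..} g"
    unfolding g_def[abs_def] by (rule edge_kernel(2,3)[OF k_int k_cont k_anti P])+
  have \<eta>_cont: "continuous_on {0<..} \<eta>"
    using ek by (auto intro!: continuous_at_imp_continuous_on DERIV_isCont)
  have energy: "interaction_energy K (\<Omega> q) = 4 * m\<^sup>2 * integral {0..1} (\<lambda>s.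
     \<eta> (q + s\<^sup>2 / q - 2 * s * cos \<alpha>) + \<eta> (q * s\<^sup>2 + 1 / q - 2 * s * cos \<alpha>)
     + \<eta> (q * s\<^sup>2 + (1 - s)\<^sup>2 / q + 2 * s * (1 - s) * cos \<alpha>))" if "q \<ge> 1" for q
    using \<eta>_cont unfolding \<eta>_def[abs_def] P_def energy_k
    by (intro triangle_interaction_energy[OF assms(7)[OF that] assms(4-6) k_int]) simp_all
  show ?thesis
  proof (rule monotone_onI)
    fix p q :: real assume pq: "p \<in> {1..}" "q \<in> {1..}" "p < q"
    have "4 * m\<^sup>2 > 0" using assms(4) by simp
    then show "interaction_energy K (\<Omega> p) > interaction_energy K (\<Omega> q)"
      using monotone_onD[OF edge_integrals_strict_antimono[OF ek g c] pq] pq(1,2)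
      by (simp add: energy)
  qed
qed

end
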